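(* Let $N\ge1$, let $q\in\mathbb{C}^\ast$ be not a root of unity, let $V=\mathbb{C}^{N+1}$ be the fundamental representation of $\mathcal{U}_q\mathfrak{sl}_{N+1}$, and let $c$ be the braiding $q^{-1}R_\rho$ on $V$. For any $p$ with $1\le p\le N+1$ and any $A\in\mathrm{End}\bigwedge_c^p(V)$, the q-trace $\mathrm{Tr}_qA$ and the quantum trace $\mathrm{tr}_qA$ are related by $$\mathrm{Tr}_q A=q^{-p(N+1-p)}\,\mathrm{tr}_q A.$$
   Context: Let $e_1,\ldots,e_{N+1}$ be the standard basis of $V=\mathbb{C}^{N+1}$ and $E_{ij}$ the matrix units. The fundamental representation $\rho:\mathcal{U}_q\mathfrak{sl}_{N+1}\to\mathrm{End}\,V$ is $E_i\mapsto E_{i,i+1}$, $F_i\mapsto E_{i+1,i}$, $K_i\mapsto\sum_{l\ne i,i+1}E_{ll}+qE_{ii}+q^{-1}E_{i+1,i+1}$. The $R$-matrix acts on $V\otimes V$ by $R_\rho=q\sum_iE_{ii}\otimes E_{ii}+\sum_{i\ne j}E_{ij}\otimes E_{ji}+(q-q^{-1})\sum_{i<j}E_{jj}\otimes E_{ii}$, and $c=q^{-1}R_\rho$, i.e. $c(e_i\otimes e_i)=e_i\otimes e_i$; $c(e_i\otimes e_j)=q^{-1}e_j\otimes e_i$ for $i<j$; $c(e_i\otimes e_j)=q^{-1}e_j\otimes e_i+(1-q^{-2})e_i\otimes e_j$ for $i>j$. It is a braiding with $(c-\mathrm{id})(c+q^{-2}\mathrm{id})=0$, so $-c$ is of Hecke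 type with parameter $\nu=q^{-2}$. The quantum exterior algebra $\bigwedge_c(V)=T(V)/(\mathrm{Ker}(\mathrm{id}-c))$ is the graded algebra generated by $e_1,\ldots,e_{N+1}$ with relations $e_i\wedge e_i=0$, $e_j\wedge e_i=-q^{-1}e_i\wedge e_j$ ($i<j$); $\bigwedge_c^p(V)$ is its degree-$p$ component, with basis $e_{i_1}\wedge\cdots\wedge e_{i_p}$, $1\le i_1<\cdots<i_p\le N+1$; $\dim\bigwedge_c^{N+1}(V)=1$. It is identified with the quantum symmetric algebra of $(V,-c)$ (the element $e_{i_1}\wedge\cdots\wedge e_{i_p}$ corresponding to $\sum_{w\in\mathfrak{S}_p}T_w^{-c}(e_{i_1}\otimes\cdots\otimes e_{i_p})$, where $T_w^{-c}$ is the lift of $w$ to the braid group acting through $-c$); the quantum shuffle product becomes $\wedge$ and the deconcatenation coproduct becomes, for $i_1<\cdots<i_m$, $$\delta_{t,m-t}(e_{i_1}\wedge\cdots\wedge e_{i_m})=\sum_{w\in\mathfrak{S}_{t,m-t}}(-q)^{-l(w)}e_{i_{w(1)}}\wedge\cdots\wedge e_{i_{w(t)}}\otimes e_{i_{w(t+1)}}\wedge\cdots\wedge e_{i_{w(m)}},$$ where $\mathfrak{S}_{t,m-t}$ is the set of $w\in\mathfrak{S}_m$ increasing on $\{1,\ldots,t\}$ and on $\{t+1,\ldots,m\}$, and $l$ is the length. Convolution: for $A\in\mathrm{End}\bigwedge_c^i(V)$, $B\in\mathrm{End}\bigwedge_c^j(V)$, $A\ast B=\wedge\circ(A\otimes B)\circ\delta_{i,j}\in\mathrm{End}\bigwedge_c^{i+j}(V)$.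 With $\mathrm{I}_m$ the identity of $\bigwedge_c^m(V)$, the q-trace of $A\in\mathrm{End}\bigwedge_c^p(V)$ is the unique scalar $\mathrm{Tr}_qA$ with $A\ast\mathrm{I}_{N+1-p}=(\mathrm{Tr}_qA)\,\mathrm{I}_{N+1}$. Quantum trace: let $K=\prod_{i=1}^NK_i^{i(N+1-i)}\in\mathcal{U}_q\mathfrak{sl}_{N+1}$ and let $\rho^p$ be the representation on $\bigwedge_c^p(V)$ induced by $\rho$; since $K$ is group-like, $\rho^p(K)(e_{i_1}\wedge\cdots\wedge e_{i_p})=\rho(K)e_{i_1}\wedge\cdots\wedge\rho(K)e_{i_p}$. Then $\mathrm{tr}_qA=\mathrm{Tr}(\rho^p(K)A)$, where $\mathrm{Tr}$ is the usual trace. *)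

theory Defs
  imports Complex_Main "HOL-Library.Poly_Mapping" "HOL-Combinatorics.Permutations"
    "HOL-Algebra.QuotRing"
begin

section \<open>The tensor algebra\<close>

text \<open>Words under concatenation form the free monoid, so that \<open>nat list \<Rightarrow>\<^sub>0 complex\<close> with the
  multiplication of \<^theory>\<open>HOL-Library.Poly_Mapping\<close> is the free algebra; the word
  \<open>[i\<^sub>1, \<dots>, i\<^sub>m]\<close> stands for the tensor of the basis vectors with these indices.
  Basis vectors are numbered from 1 to \<open>N + 1\<close>, positions in a word from 0.\<close>

instantiation list :: (type) monoid_add
begin

definition zero_list :: "'a list" where "zero_list = []"

definition plus_list :: "'a list \<Rightarrow> 'a list \<Rightarrow> 'a list" where "plus_list = (@)"

instance by standard (simp_all add: zero_list_def plus_list_def)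

end

type_synonym tensor = "nat list \<Rightarrow>\<^sub>0 complex"

definition tensor_alg :: "nat \<Rightarrow> tensor ring" where
  "tensor_alg N = \<lparr>carrier = {x. Poly_Mapping.keys x \<subseteq> lists {1..N+1}},
     mult = (*), one = 1, zero = 0, add = (+)\<rparr>"

definition tensor_pow :: "nat \<Rightarrow> nat \<Rightarrow> tensor set" where
  "tensor_pow N p = {x. Poly_Mapping.keys x \<subseteq> {w \<in> lists {1..N+1}. length w = p}}"

definition tscale :: "complex \<Rightarrow> tensor \<Rightarrow> tensor" where
  "tscale s x = Poly_Mapping.single [] s * x"

definition e :: "nat \<Rightarrow> tensor" where
  "e i = Poly_Mapping.single [i] 1"

text \<open>The actions of the matrix units \<open>E\<^sub>i\<^sub>j\<close> on \<open>V\<close> and of \<open>E\<^sub>i\<^sub>j \<otimes> E\<^sub>k\<^sub>l\<close> on \<open>V \<otimes> V\<close>.\<close>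

definition E1 :: "nat \<Rightarrow> nat \<Rightarrow> tensor \<Rightarrow> tensor" where
  "E1 i j x = Poly_Mapping.single [i] (Poly_Mapping.lookup x [j])"

definition E2 :: "nat \<Rightarrow> nat \<Rightarrow> nat \<Rightarrow> nat \<Rightarrow> tensor \<Rightarrow> tensor" where
  "E2 i j k l x = Poly_Mapping.single [i, k] (Poly_Mapping.lookup x [j, l])"


section \<open>The braiding and the quantum exterior algebra\<close>

definition R_rho :: "nat \<Rightarrow> complex \<Rightarrow> tensor \<Rightarrow> tensor" where
  "R_rho N q x =
     tscale q (\<Sum>i\<in>{1..N+1}. E2 i i i i x)
     + (\<Sum>(i, j)\<in>{(i, j). i \<in> {1..N+1} \<and> j \<in> {1..N+1} \<and> i \<noteq> j}. E2 i j j i x)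
     + tscale (q - inverse q)
         (\<Sum>(i, j)\<in>{(i, j). i \<in> {1..N+1} \<and> j \<in> {1..N+1} \<and> i < j}. E2 j j i i x)"

definition braiding :: "nat \<Rightarrow> complex \<Rightarrow> tensor \<Rightarrow> tensor" where
  "braiding N q x = tscale (inverse q) (R_rho N q x)"

definition ext_ideal :: "nat \<Rightarrow> complex \<Rightarrow> tensor set" where
  "ext_ideal N q = Idl\<^bsub>tensor_alg N\<^esub> {x \<in> tensor_pow N 2. x - braiding N q x = 0}"

text \<open>Elements of the quantum exterior algebra are cosets of the ideal.\<close>

definition ext_alg :: "nat \<Rightarrow> complex \<Rightarrow> tensor set ring" where
  "ext_alg N q = tensor_alg N Quot ext_ideal N q"

definition ext_class :: "nat \<Rightarrow> complex \<Rightarrow> tensor \<Rightarrow> tensor set" where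
  "ext_class N q x = ext_ideal N q +>\<^bsub>tensor_alg N\<^esub> x"

definition ext_scale :: "nat \<Rightarrow> complex \<Rightarrow> complex \<Rightarrow> tensor set \<Rightarrow> tensor set" where
  "ext_scale N q s X = (\<Union>x\<in>X. ext_class N q (tscale s x))"

definition ext_pow :: "nat \<Rightarrow> complex \<Rightarrow> nat \<Rightarrow> tensor set set" where
  "ext_pow N q p = ext_class N q ` tensor_pow N p"

definition ext_End :: "nat \<Rightarrow> complex \<Rightarrow> nat \<Rightarrow> (tensor set \<Rightarrow> tensor set) set" where
  "ext_End N q p = {A. A \<in> ext_pow N q p \<rightarrow> ext_pow N q p
     \<and> (\<forall>X\<in>ext_pow N q p. \<forall>Y\<in>ext_pow N q p.
          A (X \<oplus>\<^bsub>ext_alg N q\<^esub> Y) = A X \<oplus>\<^bsub>ext_alg N q\<^esub> A Y)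
     \<and> (\<forall>s. \<forall>X\<in>ext_pow N q p. A (ext_scale N q s X) = ext_scale N q s (A X))}"

definition wedge_list :: "nat \<Rightarrow> complex \<Rightarrow> tensor list \<Rightarrow> tensor set" where
  "wedge_list N q vs =
     foldr (\<lambda>v X. ext_class N q v \<otimes>\<^bsub>ext_alg N q\<^esub> X) vs \<one>\<^bsub>ext_alg N q\<^esub>"

text \<open>The index sequences \<open>i\<^sub>1 < \<dots> < i\<^sub>p\<close>, and the corresponding basis of the component of
  degree \<open>p\<close>.\<close>

definition incr :: "nat \<Rightarrow> nat \<Rightarrow> nat list set" where
  "incr N p = {I. sorted_wrt (<) I \<and> set I \<subseteq> {1..N+1} \<and> length I = p}"

definition e_wedge :: "nat \<Rightarrow> complex \<Rightarrow> nat list \<Rightarrow> tensor set" where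
  "e_wedge N q I = wedge_list N q (map e I)"

definition coords :: "nat \<Rightarrow> complex \<Rightarrow> nat \<Rightarrow> tensor set \<Rightarrow> nat list \<Rightarrow> complex" where
  "coords N q p X = (THE a. (\<forall>I. I \<notin> incr N p \<longrightarrow> a I = 0) \<and>
     X = (\<Oplus>\<^bsub>ext_alg N q\<^esub>I\<in>incr N p. ext_scale N q (a I) (e_wedge N q I)))"


section \<open>Coproduct, convolution and q-trace\<close>

definition shuffles_on :: "nat \<Rightarrow> nat \<Rightarrow> (nat \<Rightarrow> nat) set" where
  "shuffles_on t m = {w. w permutes {..<m} \<and> strict_mono_on {..<t} w \<and> strict_mono_on {t..<m} w}"

definition perm_length :: "nat \<Rightarrow> (nat \<Rightarrow> nat) \<Rightarrow> nat" where
  "perm_length m w = card {(a, b). a < b \<and> b < m \<and> w b < w a}"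

text \<open>The tensor product of the components of degrees \<open>i\<close> and \<open>j\<close> has as basis the tensors of
  their basis elements; its elements are written as families of coefficients indexed by
  \<^term>\<open>incr N i \<times> incr N j\<close>.\<close>

type_synonym ext_tensor = "nat list \<times> nat list \<Rightarrow> complex"

definition delta :: "nat \<Rightarrow> complex \<Rightarrow> nat \<Rightarrow> nat \<Rightarrow> tensor set \<Rightarrow> ext_tensor" where
  "delta N q t r X = (\<lambda>(J, L). \<Sum>I\<in>incr N (t + r). coords N q (t + r) X I *
     (\<Sum>w\<in>shuffles_on t (t + r).
        if J = map (\<lambda>k. I ! w k) [0..<t] \<and> L = map (\<lambda>k. I ! w k) [t..<t+r]
        then (- q) powi (- int (perm_length (t + r) w)) else 0))"

definition tensor_map :: "nat \<Rightarrow> complex \<Rightarrow> nat \<Rightarrow> nat \<Rightarrow> (tensor set \<Rightarrow> tensor set) \<Rightarrow>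
    (tensor set \<Rightarrow> tensor set) \<Rightarrow> ext_tensor \<Rightarrow> ext_tensor" where
  "tensor_map N q i j A B u = (\<lambda>(J', L'). \<Sum>(J, L)\<in>incr N i \<times> incr N j.
     u (J, L) * (coords N q i (A (e_wedge N q J)) J' * coords N q j (B (e_wedge N q L)) L'))"

definition wedge_map :: "nat \<Rightarrow> complex \<Rightarrow> nat \<Rightarrow> nat \<Rightarrow> ext_tensor \<Rightarrow> tensor set" where
  "wedge_map N q i j u = (\<Oplus>\<^bsub>ext_alg N q\<^esub>P\<in>incr N i \<times> incr N j.
     ext_scale N q (u P) (e_wedge N q (fst P) \<otimes>\<^bsub>ext_alg N q\<^esub> e_wedge N q (snd P)))"

definition conv :: "nat \<Rightarrow> complex \<Rightarrow> nat \<Rightarrow> nat \<Rightarrow> (tensor set \<Rightarrow> tensor set) \<Rightarrow>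
    (tensor set \<Rightarrow> tensor set) \<Rightarrow> tensor set \<Rightarrow> tensor set" where
  "conv N q i j A B = wedge_map N q i j \<circ> tensor_map N q i j A B \<circ> delta N q i j"

definition q_trace :: "nat \<Rightarrow> complex \<Rightarrow> nat \<Rightarrow> (tensor set \<Rightarrow> tensor set) \<Rightarrow> complex" where
  "q_trace N q p A = (THE s. \<forall>X\<in>ext_pow N q (N + 1).
     conv N q p (N + 1 - p) A id X = ext_scale N q s X)"


section \<open>The quantum trace\<close>

definition rho_K_gen :: "nat \<Rightarrow> complex \<Rightarrow> nat \<Rightarrow> tensor \<Rightarrow> tensor" where
  "rho_K_gen N q i x = (\<Sum>l\<in>{1..N+1} - {i, i+1}. E1 l l x)
     + tscale q (E1 i i x) + tscale (inverse q) (E1 (i+1) (i+1) x)"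

text \<open>The image of \<open>K = \<Prod>\<^sub>i K\<^sub>i\<^bsup>i(N+1-i)\<^esup>\<close>; only its action on \<open>V\<close> is used.\<close>

definition rho_K :: "nat \<Rightarrow> complex \<Rightarrow> tensor \<Rightarrow> tensor" where
  "rho_K N q = foldr (\<circ>) (map (\<lambda>i. rho_K_gen N q i ^^ (i * (N + 1 - i))) [1..<N+1]) id"

text \<open>Since \<open>K\<close> is group-like, it acts on a product of vectors factor by factor.\<close>

definition rho_pow_K :: "nat \<Rightarrow> complex \<Rightarrow> nat \<Rightarrow> tensor set \<Rightarrow> tensor set" where
  "rho_pow_K N q p X = (\<Oplus>\<^bsub>ext_alg N q\<^esub>I\<in>incr N p.
     ext_scale N q (coords N q p X I) (wedge_list N q (map (\<lambda>i. rho_K N q (e i)) I)))"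

definition ext_trace :: "nat \<Rightarrow> complex \<Rightarrow> nat \<Rightarrow> (tensor set \<Rightarrow> tensor set) \<Rightarrow> complex" where
  "ext_trace N q p A = (\<Sum>I\<in>incr N p. coords N q p (A (e_wedge N q I)) I)"

definition quantum_trace :: "nat \<Rightarrow> complex \<Rightarrow> nat \<Rightarrow> (tensor set \<Rightarrow> tensor set) \<Rightarrow> complex" where
  "quantum_trace N q p A = ext_trace N q p (rho_pow_K N q p \<circ> A)"

end

theory Submission
  imports Defs
begin

text \<open>Straightening a word by adjacent swaps, each contributing a factor \<open>- q\<^sup>-\<^sup>1\<close>, and killing
  words with a repeated letter gives a linear projection of the tensor algebra whose kernel is
  exactly the ideal generated by \<open>Ker (id - c)\<close>; so coordinates in the exterior algebra are
  coefficients of this normal form. Let \<open>J\<close> be an increasing index sequence of length \<open>p\<close>, \<open>L\<close> its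
  complement and \<open>l\<close> the number of inversions of \<open>J @ L\<close>. In the convolution with the identity on
  the top component, the coproduct and the product each contribute \<open>(- q)\<close> to the power \<open>- l\<close>, so the
  q-trace is the sum of the \<open>A\<^sub>J\<^sub>J\<close> weighted by \<open>q\<close> to the power \<open>- 2 l\<close>. On the other side \<open>K\<close> acts on
  \<open>e\<^sub>j\<close> by \<open>q\<close> to the power \<open>N + 2 - 2 j\<close>, and \<open>2 l + p (p + 1)\<close> is twice the sum of \<open>J\<close>.\<close>

section \<open>Normal forms\<close>

abbreviation word :: "nat list \<Rightarrow> complex \<Rightarrow> tensor" where
  "word \<equiv> Poly_Mapping.single"

primrec inversions :: "nat list \<Rightarrow> nat" where
  "inversions [] = 0"
| "inversions (x # xs) = length (filter (\<lambda>y. y < x) xs) + inversions xs"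

text \<open>In the exterior algebra, the product of the \<open>e\<^sub>i\<close> along a word \<open>w\<close> is \<open>wedge_sign q w\<close> times
  the product along \<open>sort w\<close>.\<close>

definition wedge_sign :: "complex \<Rightarrow> nat list \<Rightarrow> complex" where
  "wedge_sign q w = (if distinct w then (- inverse q) ^ inversions w else 0)"

definition normal_form :: "complex \<Rightarrow> tensor \<Rightarrow> tensor" where
  "normal_form q x = (\<Sum>w\<in>Poly_Mapping.keys x.
     word (sort w) (Poly_Mapping.lookup x w * wedge_sign q w))"

section \<open>Expansion of tensors in words and linearity of the normal form\<close>

lemma word_mult: "word u s * word v t = word (u @ v) (s * t)"
  by (simp add: mult_single plus_list_def)

lemma tscale_word [simp]: "tscale s (word w t) = word w (s * t)"
  by (simp add: tscale_def word_mult)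

lemma tensor_decomp: "x = (\<Sum>w\<in>Poly_Mapping.keys x. word w (Poly_Mapping.lookup x w))"
  for x :: tensor
proof (rule poly_mapping_eqI)
  fix k
  have "Poly_Mapping.lookup (word w (Poly_Mapping.lookup x w)) k =
    (if w = k then Poly_Mapping.lookup x w else 0)" for w
    by (simp add: lookup_single when_def)
  then show "Poly_Mapping.lookup x k =
      Poly_Mapping.lookup (\<Sum>w\<in>Poly_Mapping.keys x. word w (Poly_Mapping.lookup x w)) k"
    by (simp add: lookup_sum in_keys_iff)
qed

lemma tensor_decomp_superset:
  assumes "finite S" "Poly_Mapping.keys x \<subseteq> S"
  shows "x = (\<Sum>w\<in>S. word w (Poly_Mapping.lookup x w))"
  using assms by (subst tensor_decomp, intro sum.mono_neutral_left) (auto simp: in_keys_iff)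

lemma lookup_tscale [simp]: "Poly_Mapping.lookup (tscale s x) w = s * Poly_Mapping.lookup x w"
proof -
  have "tscale s x = (\<Sum>v\<in>Poly_Mapping.keys x. word v (s * Poly_Mapping.lookup x v))"
    by (subst (1) tensor_decomp) (simp add: tscale_def sum_distrib_left word_mult)
  then show ?thesis
    by (simp add: lookup_sum lookup_single when_def in_keys_iff)
qed

text \<open>The support of a sum can be smaller than the union of the supports, so linearity is
  checked over a common finite superset; the added words have coefficient 0.\<close>

lemma normal_form_superset:
  assumes "finite S" "Poly_Mapping.keys x \<subseteq> S"
  shows "normal_form q x = (\<Sum>w\<in>S. word (sort w) (Poly_Mapping.lookup x w * wedge_sign q w))"
  unfolding normal_form_def using assms
  by (intro sum.mono_neutral_left) (auto simp: in_keys_iff)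

lemma normal_form_zero [simp]: "normal_form q 0 = 0"
  by (simp add: normal_form_def)

lemma normal_form_add: "normal_form q (x + y) = normal_form q x + normal_form q y"
proof -
  have "Poly_Mapping.keys (x + y) \<subseteq> Poly_Mapping.keys x \<union> Poly_Mapping.keys y"
    by (rule keys_add)
  then show ?thesis
    by (simp add: normal_form_superset[of "Poly_Mapping.keys x \<union> Poly_Mapping.keys y"]
        lookup_add distrib_right single_add sum.distrib)
qed

lemma normal_form_uminus: "normal_form q (- x) = - normal_form q x"
  using normal_form_add[of q x "- x"] by (simp add: eq_neg_iff_add_eq_0 add.commute)

lemma normal_form_diff: "normal_form q (x - y) = normal_form q x - normal_form q y"
  using normal_form_add[of q x "- y"] by (simp add: normal_form_uminus)

lemma normal_form_sum: "normal_form q (sum f S) = (\<Sum>i\<in>S. normal_form q (f i))"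
  by (induction S rule: infinite_finite_induct) (simp_all add: normal_form_add)

lemma normal_form_word: "normal_form q (word w s) = word (sort w) (s * wedge_sign q w)"
  using normal_form_superset[of "{w}" "word w s" q] by simp

section \<open>Signs of words under adjacent swaps\<close>

lemma inversions_sorted: "sorted w \<Longrightarrow> inversions w = 0"
  by (induction w) (auto simp: filter_empty_conv)

lemma wedge_sign_strict_sorted: "sorted_wrt (<) w \<Longrightarrow> wedge_sign q w = 1"
  by (simp add: strict_sorted_iff wedge_sign_def inversions_sorted)

lemma normal_form_strict_sorted:
  "sorted_wrt (<) w \<Longrightarrow> normal_form q (word w s) = word w s"
  by (simp add: normal_form_word wedge_sign_strict_sorted strict_sorted_iff sorted_sort_id)

text \<open>Only the relative order of the two swapped letters changes: every other letter still
  sees the same letters to its right.\<close>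

lemma inversions_swap:
  "a < b \<Longrightarrow> inversions (u @ b # a # v) = Suc (inversions (u @ a # b # v))"
  by (induction u) auto

lemma sort_swap: "sort (u @ b # a # v) = sort (u @ a # b # (v :: nat list))"
  by (rule properties_for_sort) (auto simp: ac_simps)

lemma wedge_sign_swap:
  "a < b \<Longrightarrow> wedge_sign q (u @ b # a # v) = - inverse q * wedge_sign q (u @ a # b # v)"
proof -
  assume "a < b"
  moreover have "distinct (u @ b # a # v) \<longleftrightarrow> distinct (u @ a # b # v)"
    by auto
  ultimately show ?thesis
    by (simp only: wedge_sign_def inversions_swap power_Suc if_distrib[of "(*) _"] mult_zero_right cong: if_cong)
qed

lemma wedge_sign_repeat: "wedge_sign q (u @ a # a # v) = 0"
  by (simp add: wedge_sign_def)

section \<open>The ideal of relations\<close>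

text \<open>Each word receives at most one term from each of the three sums defining R: the diagonal
  one, the flip, and the term with factor q - 1/q, which lives on words whose first letter is the
  larger one.\<close>

lemma lookup_R_rho:
  "Poly_Mapping.lookup (R_rho N q x) w =
    (if \<exists>a b. w = [a, b] \<and> a \<in> {1..N+1} \<and> b \<in> {1..N+1} then
       (if w ! 0 = w ! 1 then q * Poly_Mapping.lookup x w
        else Poly_Mapping.lookup x [w ! 1, w ! 0]
          + (if w ! 1 < w ! 0 then (q - inverse q) * Poly_Mapping.lookup x w else 0))
     else 0)"
proof -
  define P where "P = {(i, j). i \<in> {1..N+1} \<and> j \<in> {1..N+1} \<and> i \<noteq> j}"
  define Q where "Q = {(i, j). i \<in> {1..N+1} \<and> j \<in> {1..N+1} \<and> i < j}"
  have fin [simp]: "finite P" "finite Q"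
    unfolding P_def Q_def by (rule finite_subset[of _ "{1..N+1} \<times> {1..N+1}"]; auto)+
  have "Poly_Mapping.lookup (\<Sum>i\<in>{1..N+1}. E2 i i i i x) w =
      (\<Sum>i\<in>{1..N+1}. if w = [i, i] then Poly_Mapping.lookup x w else 0)"
    unfolding lookup_sum E2_def lookup_single when_def by (intro sum.cong) auto
  also have "\<dots> = (if \<exists>a. w = [a, a] \<and> a \<in> {1..N+1} then Poly_Mapping.lookup x w else 0)"
  proof (cases "\<exists>a. w = [a, a]")
    case True
    then obtain a where w: "w = [a, a]" by blast
    show ?thesis by (simp add: w)
  qed (auto intro!: sum.neutral)
  finally have 1: "Poly_Mapping.lookup (\<Sum>i\<in>{1..N+1}. E2 i i i i x) w = \<dots>" .
  have "Poly_Mapping.lookup (\<Sum>(i, j)\<in>P. E2 i j j i x) w =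
      (\<Sum>p\<in>P. if w = [fst p, snd p] then Poly_Mapping.lookup x [snd p, fst p] else 0)"
    unfolding lookup_sum E2_def case_prod_beta lookup_single when_def by (intro sum.cong) auto
  also have "\<dots> = (if \<exists>a b. w = [a, b] \<and> (a, b) \<in> P then
      Poly_Mapping.lookup x [w ! 1, w ! 0] else 0)"
  proof (cases "\<exists>a b. w = [a, b]")
    case True
    then obtain a b where w: "w = [a, b]" by blast
    \<comment> \<open>The word determines the pair, so the sum becomes a Kronecker delta.\<close>
    have "(\<Sum>p\<in>P. if w = [fst p, snd p] then Poly_Mapping.lookup x [snd p, fst p] else 0) =
       (\<Sum>p\<in>P. if (a, b) = p then Poly_Mapping.lookup x [b, a] else 0)"
      by (intro sum.cong) (auto simp: w)
    then show ?thesis by (simp add: w del: prod.inject)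
  qed (auto intro!: sum.neutral)
  finally have 2: "Poly_Mapping.lookup (\<Sum>(i, j)\<in>P. E2 i j j i x) w = \<dots>" .
  have "Poly_Mapping.lookup (\<Sum>(i, j)\<in>Q. E2 j j i i x) w =
      (\<Sum>p\<in>Q. if w = [snd p, fst p] then Poly_Mapping.lookup x w else 0)"
    unfolding lookup_sum E2_def case_prod_beta lookup_single when_def by (intro sum.cong) auto
  also have "\<dots> = (if \<exists>a b. w = [a, b] \<and> (b, a) \<in> Q then Poly_Mapping.lookup x w else 0)"
  proof (cases "\<exists>a b. w = [a, b]")
    case True
    then obtain a b where w: "w = [a, b]" by blast
    have "(\<Sum>p\<in>Q. if w = [snd p, fst p] then Poly_Mapping.lookup x w else 0) =
       (\<Sum>p\<in>Q. if (b, a) = p then Poly_Mapping.lookup x [a, b] else 0)"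
      by (intro sum.cong) (auto simp: w)
    then show ?thesis by (simp add: w del: prod.inject)
  qed (auto intro!: sum.neutral)
  finally have 3: "Poly_Mapping.lookup (\<Sum>(i, j)\<in>Q. E2 j j i i x) w = \<dots>" .
  note R = R_rho_def[of N q x, folded P_def Q_def]
  show ?thesis
  proof (cases "\<exists>a b. w = [a, b]")
    case True
    then obtain a b where w: "w = [a, b]" by blast
    have c: "(\<exists>a. w = [a, a] \<and> a \<in> {1..N+1}) \<longleftrightarrow> a = b \<and> a \<in> {1..N+1}"
      "(\<exists>a b. w = [a, b] \<and> (a, b) \<in> P) \<longleftrightarrow> a \<in> {1..N+1} \<and> b \<in> {1..N+1} \<and> a \<noteq> b"
      "(\<exists>a b. w = [a, b] \<and> (b, a) \<in> Q) \<longleftrightarrow> a \<in> {1..N+1} \<and> b \<in> {1..N+1} \<and> b < a"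
      "(\<exists>a b. w = [a, b] \<and> a \<in> {1..N+1} \<and> b \<in> {1..N+1}) \<longleftrightarrow> a \<in> {1..N+1} \<and> b \<in> {1..N+1}"
      "w ! 0 = a" "w ! 1 = b"
      by (auto simp: w P_def Q_def)
    have "Poly_Mapping.lookup (R_rho N q x) w =
      q * (if a = b \<and> a \<in> {1..N+1} then Poly_Mapping.lookup x w else 0) +
      (if a \<in> {1..N+1} \<and> b \<in> {1..N+1} \<and> a \<noteq> b then Poly_Mapping.lookup x [b, a] else 0) +
      (q - inverse q) * (if a \<in> {1..N+1} \<and> b \<in> {1..N+1} \<and> b < a then Poly_Mapping.lookup x w else 0)"
      unfolding R lookup_add lookup_tscale 1 2 3 c ..
    then show ?thesis
      unfolding c
      by (cases "a \<in> {1..N+1}"; cases "b \<in> {1..N+1}"; cases a b rule: linorder_cases)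
        (simp_all del: atLeastAtMost_iff)
  next
    case False
    then have "(\<nexists>a b. w = [a, b] \<and> B a b)" "(\<nexists>a. w = [a, a] \<and> C a)" for B C
      by blast+
    then show ?thesis
      unfolding R lookup_add lookup_tscale 1 2 3 by (simp only: if_False mult_zero_right add_0_right)
  qed
qed

text \<open>For a < b the coefficient of [a, b] in x = c(x) gives x_ab = x_ba / q. That of [b, a]
  gives x_ba = x_ab / q + (1 - q^-2) x_ba, which is the same equation, and the diagonal coefficients
  are unconstrained.\<close>

lemma braiding_fixed_iff:
  assumes "q \<noteq> 0" "x \<in> tensor_pow N 2"
  shows "x - braiding N q x = 0 \<longleftrightarrow>
    (\<forall>a\<in>{1..N+1}. \<forall>b\<in>{1..N+1}. a < b \<longrightarrow>
       Poly_Mapping.lookup x [b, a] = q * Poly_Mapping.lookup x [a, b])"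
proof -
  let ?l = "Poly_Mapping.lookup x"
  have out: "?l w = 0" if "\<nexists>a b. w = [a, b] \<and> a \<in> {1..N+1} \<and> b \<in> {1..N+1}" for w
  proof (rule ccontr)
    assume "?l w \<noteq> 0"
    then have "w \<in> lists {1..N+1}" "length w = 2"
      using assms(2) by (auto simp: tensor_pow_def in_keys_iff subset_iff)
    then show False
      using that by (auto simp: length_Suc_conv numeral_2_eq_2)
  qed
  have "x - braiding N q x = 0 \<longleftrightarrow> (\<forall>w. ?l w = Poly_Mapping.lookup (braiding N q x) w)"
    by (metis eq_iff_diff_eq_0 poly_mapping_eqI)
  also have "\<dots> \<longleftrightarrow> (\<forall>a\<in>{1..N+1}. \<forall>b\<in>{1..N+1}.
      ?l [a, b] = Poly_Mapping.lookup (braiding N q x) [a, b])"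
  proof (intro iffI allI ballI)
    fix w
    assume *: "\<forall>a\<in>{1..N+1}. \<forall>b\<in>{1..N+1}.
      ?l [a, b] = Poly_Mapping.lookup (braiding N q x) [a, b]"
    show "?l w = Poly_Mapping.lookup (braiding N q x) w"
    proof (cases "\<exists>a b. w = [a, b] \<and> a \<in> {1..N+1} \<and> b \<in> {1..N+1}")
      case False
      then show ?thesis
        unfolding out[OF False] braiding_def lookup_tscale lookup_R_rho by (simp only: if_False mult_zero_right)
    qed (use * in blast)
  qed blast
  also have "\<dots> \<longleftrightarrow> (\<forall>a\<in>{1..N+1}. \<forall>b\<in>{1..N+1}. a < b \<longrightarrow>
      ?l [b, a] = q * ?l [a, b])"
  proof (intro iffI ballI impI)
    fix a b
    assume "\<forall>a\<in>{1..N+1}. \<forall>b\<in>{1..N+1}.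
      ?l [a, b] = Poly_Mapping.lookup (braiding N q x) [a, b]"
      and ab: "a \<in> {1..N+1}" "b \<in> {1..N+1}" "a < b"
    then have "?l [a, b] = Poly_Mapping.lookup (braiding N q x) [a, b]" by blast
    then show "?l [b, a] = q * ?l [a, b]"
      using ab assms(1) by (auto simp: braiding_def lookup_R_rho field_simps)
  next
    fix a b
    assume *: "\<forall>a\<in>{1..N+1}. \<forall>b\<in>{1..N+1}. a < b \<longrightarrow> ?l [b, a] = q * ?l [a, b]"
      and ab: "a \<in> {1..N+1}" "b \<in> {1..N+1}"
    consider "a = b" | "a < b" "?l [b, a] = q * ?l [a, b]" | "b < a" "?l [a, b] = q * ?l [b, a]"
      using * ab by (metis linorder_neqE_nat)
    then show "?l [a, b] = Poly_Mapping.lookup (braiding N q x) [a, b]"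
      using ab assms(1)
      by cases (auto simp: braiding_def lookup_R_rho field_simps)
  qed
  finally show ?thesis .
qed

section \<open>The tensor algebra as a ring and closure properties of the ideal\<close>

lemma tensor_alg_simps:
  "x \<in> carrier (tensor_alg N) \<longleftrightarrow> Poly_Mapping.keys x \<subseteq> lists {1..N+1}"
  "mult (tensor_alg N) = (*)" "one (tensor_alg N) = 1"
  "zero (tensor_alg N) = 0" "add (tensor_alg N) = (+)"
  by (simp_all add: tensor_alg_def)

lemma word_carrier: "w \<in> lists {1..N+1} \<Longrightarrow> word w s \<in> carrier (tensor_alg N)"
  by (simp add: tensor_alg_simps)

lemma tensor_pow_carrier: "x \<in> tensor_pow N p \<Longrightarrow> x \<in> carrier (tensor_alg N)"
  by (auto simp: tensor_alg_simps tensor_pow_def)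

lemma ring_tensor_alg: "ring (tensor_alg N)"
proof (rule ringI)
  show "abelian_group (tensor_alg N)"
  proof (rule abelian_groupI)
    fix x y assume "x \<in> carrier (tensor_alg N)" "y \<in> carrier (tensor_alg N)"
    then show "x \<oplus>\<^bsub>tensor_alg N\<^esub> y \<in> carrier (tensor_alg N)"
      using keys_add[of x y] by (auto simp: tensor_alg_simps)
  next
    fix x assume "x \<in> carrier (tensor_alg N)"
    then show "\<exists>y\<in>carrier (tensor_alg N). y \<oplus>\<^bsub>tensor_alg N\<^esub> x = \<zero>\<^bsub>tensor_alg N\<^esub>"
      by (intro bexI[of _ "- x"]) (auto simp: tensor_alg_simps in_keys_iff subset_iff)
  qed (auto simp: tensor_alg_simps ac_simps)
  show "Group.monoid (tensor_alg N)"
  proof (rule Group.monoidI)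
    fix x y assume "x \<in> carrier (tensor_alg N)" "y \<in> carrier (tensor_alg N)"
    then show "x \<otimes>\<^bsub>tensor_alg N\<^esub> y \<in> carrier (tensor_alg N)"
      using keys_mult[of x y] by (fastforce simp: tensor_alg_simps plus_list_def)
  qed (auto simp: tensor_alg_simps ac_simps zero_list_def)
qed (auto simp: tensor_alg_simps algebra_simps)

lemma generators_subset:
  "{x \<in> tensor_pow N 2. x - braiding N q x = 0} \<subseteq> carrier (tensor_alg N)"
  by (auto intro: tensor_pow_carrier)

lemma ideal_ext_ideal: "ideal (ext_ideal N q) (tensor_alg N)"
  unfolding ext_ideal_def by (rule ring.genideal_ideal[OF ring_tensor_alg generators_subset])

lemma generator_mem:
  "x \<in> tensor_pow N 2 \<Longrightarrow> x - braiding N q x = 0 \<Longrightarrow> x \<in> ext_ideal N q"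
  unfolding ext_ideal_def
  using ring.genideal_self[OF ring_tensor_alg generators_subset, of N q] by blast

lemma ext_ideal_add: "x \<in> ext_ideal N q \<Longrightarrow> y \<in> ext_ideal N q \<Longrightarrow> x + y \<in> ext_ideal N q"
  using additive_subgroup.a_closed[OF ideal.axioms(1)[OF ideal_ext_ideal], of x N q y]
  by (simp add: tensor_alg_simps)

lemma ext_ideal_zero: "0 \<in> ext_ideal N q"
  using additive_subgroup.zero_closed[OF ideal.axioms(1)[OF ideal_ext_ideal], of N q]
  by (simp add: tensor_alg_simps)

lemma ext_ideal_sum: "(\<And>i. i \<in> S \<Longrightarrow> f i \<in> ext_ideal N q) \<Longrightarrow> sum f S \<in> ext_ideal N q"
  by (induction S rule: infinite_finite_induct) (auto intro: ext_ideal_add ext_ideal_zero)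

lemma ext_ideal_mult:
  assumes "x \<in> ext_ideal N q" "a \<in> carrier (tensor_alg N)"
  shows "a * x \<in> ext_ideal N q" "x * a \<in> ext_ideal N q"
  using ideal.I_l_closed[OF ideal_ext_ideal assms] ideal.I_r_closed[OF ideal_ext_ideal assms]
  by (simp_all add: tensor_alg_simps)

text \<open>Between two monomials, the terms of x at [i, j] and [j, i] cancel: for i < j the
  coefficients have ratio q and the signs have ratio -1/q. Terms at [i, i] vanish because a letter
  is repeated.\<close>

lemma normal_form_generator:
  assumes "q \<noteq> 0" and x: "x \<in> tensor_pow N 2" "x - braiding N q x = 0"
  shows "normal_form q (a * x * b) = 0"
proof -
  let ?l = "Poly_Mapping.lookup x" and ?S = "{1..N+1}"
  have keys: "Poly_Mapping.keys x \<subseteq> (\<lambda>(i, j). [i, j]) ` (?S \<times> ?S)"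
  proof
    fix w assume "w \<in> Poly_Mapping.keys x"
    then have "w \<in> lists ?S" "length w = 2"
      using x(1) by (auto simp: tensor_pow_def subset_iff)
    then show "w \<in> (\<lambda>(i, j). [i, j]) ` (?S \<times> ?S)"
      by (auto simp: length_Suc_conv numeral_2_eq_2)
  qed
  have "x = (\<Sum>w\<in>(\<lambda>(i, j). [i, j]) ` (?S \<times> ?S). word w (?l w))"
    by (rule tensor_decomp_superset[OF _ keys]) auto
  also have "\<dots> = (\<Sum>p\<in>?S \<times> ?S. word [fst p, snd p] (?l [fst p, snd p]))"
    by (subst sum.reindex) (auto simp: inj_on_def case_prod_beta)
  also have "\<dots> = (\<Sum>i\<in>?S. \<Sum>j\<in>?S. word [i, j] (?l [i, j]))"
    unfolding sum.cartesian_product case_prod_beta ..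
  finally have dx: "x = \<dots>" .
  have monomials: "normal_form q (word u s * x * word v t) = 0" for u v s t
  proof -
    \<comment> \<open>\<open>G i j\<close> is the contribution of the word [i, j] of x; it turns out
      to be antisymmetric.\<close>
    define G where
      "G i j = normal_form q (word u s * word [i, j] (?l [i, j]) * word v t)" for i j
    have anti: "G j i = - G i j" if "i < j" "i \<in> ?S" "j \<in> ?S" for i j
    proof -
      have 1: "?l [j, i] = q * ?l [i, j]"
        using braiding_fixed_iff[OF assms(1) x(1)] x(2) that by blast
      have "G j i = word (sort (u @ i # j # v))
          (s * (q * ?l [i, j]) * t * (- inverse q * wedge_sign q (u @ i # j # v)))"
        using that(1) by (simp add: G_def word_mult normal_form_word sort_swap wedge_sign_swap 1)
      also have "s * (q * ?l [i, j]) * t * (- inverse q * wedge_sign q (u @ i # j # v)) =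
          - (s * ?l [i, j] * t * wedge_sign q (u @ i # j # v))"
        using assms(1) by (simp add: field_simps)
      finally show ?thesis
        by (simp add: G_def word_mult normal_form_word single_uminus)
    qed
    have diag: "G i i = 0" for i
      by (simp add: G_def word_mult normal_form_word wedge_sign_repeat)
    have anti': "G i j = - G j i" if "i \<in> ?S" "j \<in> ?S" for i j
      using anti[of i j] anti[of j i] that diag by (cases i j rule: linorder_cases) auto
    have expand: "normal_form q (word u s * x * word v t) = (\<Sum>i\<in>?S. \<Sum>j\<in>?S. G i j)"
      unfolding G_def
      by (subst dx) (simp only: sum_distrib_left sum_distrib_right normal_form_sum)
    \<comment> \<open>Antisymmetry and an exchange of the two sums make the double sum its own
      negative.\<close>
    have "(\<Sum>i\<in>?S. \<Sum>j\<in>?S. G i j) = (\<Sum>i\<in>?S. \<Sum>j\<in>?S. - G j i)"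
      by (intro sum.cong refl anti')
    also have "\<dots> = - (\<Sum>i\<in>?S. \<Sum>j\<in>?S. G i j)"
      unfolding sum_negf by (subst sum.swap) (rule refl)
    finally have neg: "(\<Sum>i\<in>?S. \<Sum>j\<in>?S. G i j) = - (\<Sum>i\<in>?S. \<Sum>j\<in>?S. G i j)" .
    have "y = 0" if "y = - y" for y :: tensor
    proof (rule poly_mapping_eqI)
      fix k
      have "Poly_Mapping.lookup y k = - Poly_Mapping.lookup y k"
        by (subst that) simp
      then show "Poly_Mapping.lookup y k = Poly_Mapping.lookup 0 k"
        by simp
    qed
    then show ?thesis
      unfolding expand using neg by blast
  qed
  have "a * x * b = (\<Sum>v\<in>Poly_Mapping.keys b. \<Sum>u\<in>Poly_Mapping.keys a.
      word u (Poly_Mapping.lookup a u) * x * word v (Poly_Mapping.lookup b v))"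
    by (subst (1) tensor_decomp[of a], subst (1) tensor_decomp[of b])
      (simp add: sum_distrib_left sum_distrib_right)
  then show ?thesis
    by (simp add: normal_form_sum monomials)
qed

text \<open>The kernel of \<open>normal_form\<close> is not visibly an ideal, so it is replaced by
  the set \<open>K\<close> of tensors that it kills after multiplication by anything on both sides.
  This is a two-sided ideal containing the generators, hence the whole ideal; multiplying by 1
  returns to \<open>x\<close> itself.\<close>

lemma normal_form_ext_ideal:
  assumes "q \<noteq> 0" "x \<in> ext_ideal N q"
  shows "normal_form q x = 0"
proof -
  interpret ring "tensor_alg N" by (rule ring_tensor_alg)
  define K where "K = {x \<in> carrier (tensor_alg N). \<forall>a b. normal_form q (a * x * b) = 0}"
  have "ideal K (tensor_alg N)"
  proof (rule idealI[OF ring_tensor_alg])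
    show "subgroup K (add_monoid (tensor_alg N))"
    proof (rule add.subgroupI)
      show "K \<subseteq> carrier (tensor_alg N)" by (auto simp: K_def)
      show "K \<noteq> {}" by (auto simp: K_def tensor_alg_simps intro!: exI[of _ 0])
    next
      fix x assume x: "x \<in> K"
      then have "\<ominus>\<^bsub>tensor_alg N\<^esub> x = - x"
        by (intro minus_equality) (auto simp: K_def tensor_alg_simps in_keys_iff subset_iff)
      then show "\<ominus>\<^bsub>tensor_alg N\<^esub> x \<in> K"
        using x a_inv_closed[of x] by (auto simp: K_def normal_form_uminus)
    next
      fix x y assume "x \<in> K" "y \<in> K"
      then show "x \<oplus>\<^bsub>tensor_alg N\<^esub> y \<in> K"
        using a_closed[of x y]
        by (auto simp: K_def tensor_alg_simps distrib_left distrib_right normal_form_add)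
    qed
  next
    fix a x assume a: "a \<in> K" "x \<in> carrier (tensor_alg N)"
    show "x \<otimes>\<^bsub>tensor_alg N\<^esub> a \<in> K"
      using a m_closed[of x a] by (auto simp: K_def tensor_alg_simps mult.assoc[symmetric])
    have "normal_form q (b * (a * x) * c) = 0" for b c
      using a(1) by (simp add: K_def mult.assoc)
    then show "a \<otimes>\<^bsub>tensor_alg N\<^esub> x \<in> K"
      using a m_closed[of a x] by (auto simp: K_def tensor_alg_simps)
  qed
  then have "ext_ideal N q \<subseteq> K"
    unfolding ext_ideal_def
    by (rule genideal_minimal)
      (auto simp: K_def normal_form_generator[OF assms(1)] intro: tensor_pow_carrier)
  then have "normal_form q (1 * x * 1) = 0"
    using assms(2) unfolding K_def by blast
  then show ?thesis by simp
qed

text \<open>These are the defining relations of the exterior algebra. They satisfy the criterion of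
  \<open>braiding_fixed_iff\<close>, since 1 = q * (1/q).\<close>

lemma relation_mem:
  assumes "q \<noteq> 0" "a \<in> {1..N+1}" "b \<in> {1..N+1}"
  shows "a < b \<Longrightarrow> word [b, a] 1 + word [a, b] (inverse q) \<in> ext_ideal N q"
    and "word [a, a] 1 \<in> ext_ideal N q"
proof -
  assume "a < b"
  let ?x = "word [b, a] 1 + word [a, b] (inverse q)"
  have "?x \<in> tensor_pow N 2"
    using assms keys_add[of "word [b, a] 1" "word [a, b] (inverse q)"]
    by (auto simp: tensor_pow_def split: if_splits)
  moreover have "?x - braiding N q ?x = 0"
    using \<open>a < b\<close> assms(1)
    by (subst braiding_fixed_iff[OF assms(1) calculation])
      (auto simp: lookup_add lookup_single when_def)
  ultimately show "?x \<in> ext_ideal N q" by (rule generator_mem)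
next
  have "word [a, a] 1 \<in> tensor_pow N 2"
    using assms by (auto simp: tensor_pow_def)
  moreover have "word [a, a] 1 - braiding N q (word [a, a] 1) = 0"
    by (subst braiding_fixed_iff[OF assms(1) calculation])
      (auto simp: lookup_single when_def)
  ultimately show "word [a, a] 1 \<in> ext_ideal N q" by (rule generator_mem)
qed

lemma relation_word_mem:
  assumes "q \<noteq> 0" "u @ a # b # v \<in> lists {1..N+1}"
  shows "a < b \<Longrightarrow> word (u @ b # a # v) s + word (u @ a # b # v) (s * inverse q) \<in> ext_ideal N q"
    and "a = b \<Longrightarrow> word (u @ a # b # v) s \<in> ext_ideal N q"
proof -
  have ab: "a \<in> {1..N+1}" "b \<in> {1..N+1}" and
    c: "word u s \<in> carrier (tensor_alg N)" "word v 1 \<in> carrier (tensor_alg N)"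
    using assms(2) by (auto intro!: word_carrier)
  show "word (u @ b # a # v) s + word (u @ a # b # v) (s * inverse q) \<in> ext_ideal N q"
    if "a < b"
    using ext_ideal_mult(2)[OF ext_ideal_mult(1)[OF relation_mem(1)[OF assms(1) ab that] c(1)] c(2)]
    by (simp add: distrib_left distrib_right word_mult)
  show "word (u @ a # b # v) s \<in> ext_ideal N q" if "a = b"
    using ext_ideal_mult(2)[OF ext_ideal_mult(1)[OF relation_mem(2)[OF assms(1) ab] c(1)] c(2)]
    by (simp add: that word_mult)
qed

text \<open>Induction on the number of inversions. A word that is not strictly increasing has
  adjacent letters a, b with b \<le> a. If they are equal, the word lies in the ideal and its normal
  form is 0; otherwise a relation replaces it by -1/q times the swapped word, which has one
  inversion less and yields the same normal form.\<close>

lemma word_minus_normal_form: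
  assumes "q \<noteq> 0" "w \<in> lists {1..N+1}"
  shows "word w s - normal_form q (word w s) \<in> ext_ideal N q"
  using assms(2)
proof (induction "inversions w" arbitrary: w s rule: less_induct)
  case less
  consider "sorted_wrt (<) w" | u a b v where "w = u @ a # b # v" "b \<le> a"
  proof (cases "sorted_wrt (<) w")
    case False
    then obtain i where i: "Suc i < length w" "w ! Suc i \<le> w ! i"
      using sorted_wrt_iff_nth_Suc_transp[of "(<)" w] by (auto simp: not_less)
    then have "w = take i w @ w ! i # w ! Suc i # drop (Suc (Suc i)) w"
      by (metis Cons_nth_drop_Suc Suc_lessD append_take_drop_id)
    then show ?thesis using i that by blast
  qed
  then show ?case
  proof cases
    case 1
    then show ?thesis
      by (simp add: normal_form_strict_sorted ext_ideal_zero)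
  next
    case (2 u a b v)
    show ?thesis
    proof (cases "a = b")
      case True
      then show ?thesis
        using relation_word_mem(2)[OF assms(1), of u a b v N s] 2 less.prems
        by (simp add: normal_form_word wedge_sign_repeat)
    next
      case False
      then have "b < a" using 2 by simp
      let ?w = "u @ b # a # v"
      have w': "?w \<in> lists {1..N+1}" using less.prems 2 by auto
      have "word w s + word ?w (s * inverse q) \<in> ext_ideal N q"
        using relation_word_mem(1)[OF assms(1) w' \<open>b < a\<close>] 2 by simp
      moreover have "word ?w (- (s * inverse q)) - normal_form q (word ?w (- (s * inverse q)))
          \<in> ext_ideal N q"
        using less.hyps[OF _ w'] \<open>b < a\<close> 2 by (simp add: inversions_swap)
      moreover have "normal_form q (word w s) = normal_form q (word ?w (- (s * inverse q)))"
        using \<open>b < a\<close> 2 by (simp add: normal_form_word sort_swap wedge_sign_swap mult.assoc)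
      ultimately show ?thesis
        using ext_ideal_add by (fastforce simp: single_uminus)
    qed
  qed
qed

lemma minus_normal_form_mem:
  assumes "q \<noteq> 0" "x \<in> carrier (tensor_alg N)"
  shows "x - normal_form q x \<in> ext_ideal N q"
proof -
  let ?f = "\<lambda>w. word w (Poly_Mapping.lookup x w)"
  have "x - normal_form q x = (\<Sum>w\<in>Poly_Mapping.keys x. ?f w - normal_form q (?f w))"
    by (subst (1 2) tensor_decomp[of x]) (simp only: normal_form_sum sum_subtractf)
  also have "\<dots> \<in> ext_ideal N q"
    using assms by (intro ext_ideal_sum word_minus_normal_form) (auto simp: tensor_alg_simps)
  finally show ?thesis .
qed

text \<open>Straightening modulo the ideal gives one direction, vanishing of normal forms on the
  ideal the other. Equality of cosets thereby becomes equality of normal forms.\<close>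

lemma mem_ext_ideal_iff:
  assumes "q \<noteq> 0" "x \<in> carrier (tensor_alg N)"
  shows "x \<in> ext_ideal N q \<longleftrightarrow> normal_form q x = 0"
  using minus_normal_form_mem[OF assms] normal_form_ext_ideal[OF assms(1)] by auto

section \<open>Coordinates in the exterior algebra\<close>

lemma normal_form_tscale: "normal_form q (tscale s x) = tscale s (normal_form q x)"
proof -
  have "tscale s x = (\<Sum>w\<in>Poly_Mapping.keys x. word w (s * Poly_Mapping.lookup x w))"
    by (subst (1) tensor_decomp) (simp add: tscale_def sum_distrib_left word_mult)
  then show ?thesis
    by (simp add: normal_form_sum normal_form_word)
      (simp add: normal_form_def tscale_def sum_distrib_left word_mult mult.assoc)
qed

lemma ext_class_eq_iff:
  assumes "q \<noteq> 0" "x \<in> carrier (tensor_alg N)" "y \<in> carrier (tensor_alg N)"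
  shows "ext_class N q x = ext_class N q y \<longleftrightarrow> normal_form q x = normal_form q y"
proof -
  interpret ring "tensor_alg N" by (rule ring_tensor_alg)
  have "\<ominus>\<^bsub>tensor_alg N\<^esub> y = - y"
    using assms(3) by (intro minus_equality) (auto simp: tensor_alg_simps in_keys_iff subset_iff)
  then have "x \<ominus>\<^bsub>tensor_alg N\<^esub> y = x - y"
    by (simp add: a_minus_def tensor_alg_simps)
  moreover from this have "x - y \<in> carrier (tensor_alg N)"
    using assms minus_closed by metis
  ultimately show ?thesis
    using quotient_eq_iff_same_a_r_cos[OF ideal_ext_ideal assms(2,3), of q]
      mem_ext_ideal_iff[OF assms(1), of "x - y" N]
    by (simp add: ext_class_def normal_form_diff)
qed

section \<open>Computing in the quotient through representatives\<close>

lemma ring_ext_alg: "ring (ext_alg N q)"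
  unfolding ext_alg_def by (rule ideal.quotient_is_ring[OF ideal_ext_ideal])

lemma ext_class_hom: "ext_class N q \<in> ring_hom (tensor_alg N) (ext_alg N q)"
  unfolding ext_class_def[abs_def] ext_alg_def by (rule ideal.rcos_ring_hom[OF ideal_ext_ideal])

lemma ext_class_closed: "x \<in> carrier (tensor_alg N) \<Longrightarrow> ext_class N q x \<in> carrier (ext_alg N q)"
  by (rule ring_hom_closed[OF ext_class_hom])

lemma ext_class_mult:
  "x \<in> carrier (tensor_alg N) \<Longrightarrow> y \<in> carrier (tensor_alg N) \<Longrightarrow>
    ext_class N q x \<otimes>\<^bsub>ext_alg N q\<^esub> ext_class N q y = ext_class N q (x * y)"
  using ring_hom_mult[OF ext_class_hom, of x N y q] by (simp add: tensor_alg_simps)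

lemma ext_class_one: "\<one>\<^bsub>ext_alg N q\<^esub> = ext_class N q 1"
  using ring_hom_one[OF ext_class_hom, of N q] by (simp add: tensor_alg_simps)

lemma tensor_alg_sum_closed:
  "(\<And>i. i \<in> S \<Longrightarrow> f i \<in> carrier (tensor_alg N)) \<Longrightarrow> sum f S \<in> carrier (tensor_alg N)"
  using ring.ring_simprules(1)[OF ring_tensor_alg]
  by (induction S rule: infinite_finite_induct) (simp_all add: tensor_alg_simps)

text \<open>The summands are given by a separate \<open>g\<close>, so that the sums in
  \<open>coords\<close>, \<open>wedge_map\<close> and \<open>rho_pow_K\<close> match once their
  terms are recognised as classes.\<close>

lemma ext_class_sum:
  assumes "finite S" "\<And>i. i \<in> S \<Longrightarrow> f i \<in> carrier (tensor_alg N)"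
    and "\<And>i. i \<in> S \<Longrightarrow> g i = ext_class N q (f i)"
  shows "(\<Oplus>\<^bsub>ext_alg N q\<^esub>i\<in>S. g i) = ext_class N q (sum f S)"
proof -
  interpret E: ring "ext_alg N q" by (rule ring_ext_alg)
  interpret T: ring "tensor_alg N" by (rule ring_tensor_alg)
  have "(\<Oplus>\<^bsub>ext_alg N q\<^esub>i\<in>S. g i) = (\<Oplus>\<^bsub>ext_alg N q\<^esub>i\<in>S. ext_class N q (f i))"
    using assms(2,3) by (intro E.finsum_cong') (auto intro: ext_class_closed)
  also have "\<dots> = ext_class N q (sum f S)"
    using assms(1,2)
  proof (induction S rule: finite_induct)
    case empty
    then show ?case
      using ring_hom_zero[OF ext_class_hom T.ring_axioms E.ring_axioms]
      by (simp add: tensor_alg_simps)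
  next
    case (insert i S)
    then show ?case
      using ring_hom_add[OF ext_class_hom, of "f i" N "sum f S" q]
        tensor_alg_sum_closed[of S f N]
      by (simp add: ext_class_closed tensor_alg_simps(5) Pi_def)
  qed
  finally show ?thesis .
qed

lemma tscale_closed: "x \<in> carrier (tensor_alg N) \<Longrightarrow> tscale s x \<in> carrier (tensor_alg N)"
  by (auto simp: tensor_alg_simps in_keys_iff subset_iff)

text \<open>\<open>ext_scale\<close> is a union over all representatives. Scaling commutes with
  \<open>normal_form\<close>, so all of them yield the same coset and the union collapses.\<close>

lemma ext_scale_class:
  assumes "q \<noteq> 0" "x \<in> carrier (tensor_alg N)"
  shows "ext_scale N q s (ext_class N q x) = ext_class N q (tscale s x)"
proof -
  interpret I: ideal "ext_ideal N q" "tensor_alg N" by (rule ideal_ext_ideal)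
  have "ext_class N q (tscale s y) = ext_class N q (tscale s x)" if "y \<in> ext_class N q x" for y
  proof -
    have "y \<in> carrier (tensor_alg N)"
      using that assms(2) I.a_elemrcos_carrier unfolding ext_class_def by blast
    moreover have "ext_class N q x = ext_class N q y"
      using that assms(2) unfolding ext_class_def by (rule I.a_repr_independence')
    ultimately show ?thesis
      using assms by (simp add: ext_class_eq_iff tscale_closed normal_form_tscale)
  qed
  moreover have "x \<in> ext_class N q x"
    unfolding ext_class_def using assms(2) by (rule I.a_rcos_self)
  ultimately show ?thesis
    unfolding ext_scale_def by blast
qed

text \<open>The scalars \<open>f\<close> allow one statement to serve both the basis elements
  (\<open>f\<close> constantly 1) and their images under K (\<open>f\<close> the
  eigenvalues).\<close>

lemma wedge_list_words:
  "I \<in> lists {1..N+1} \<Longrightarrow>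
    wedge_list N q (map (\<lambda>i. word [i] (f i)) I) = ext_class N q (word I (prod_list (map f I)))"
proof (induction I)
  case Nil
  then show ?case
    using single_one[where ?'a = "nat list" and ?'b = complex]
    by (simp add: wedge_list_def ext_class_one zero_list_def)
next
  case (Cons i I)
  then have "i \<in> {1..N+1}" "I \<in> lists {1..N+1}" by auto
  then show ?case
    using Cons.IH ext_class_mult[of "word [i] (f i)" N "word I (prod_list (map f I))" q]
    by (simp add: wedge_list_def word_carrier word_mult del: atLeastAtMost_iff)
qed

lemma incr_lists: "I \<in> incr N p \<Longrightarrow> I \<in> lists {1..N+1}"
  by (auto simp: incr_def)

lemma e_wedge_eq: "I \<in> incr N p \<Longrightarrow> e_wedge N q I = ext_class N q (word I 1)"
proof -
  assume "I \<in> incr N p"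
  then have "wedge_list N q (map (\<lambda>i. word [i] 1) I) = ext_class N q (word I 1)"
    using wedge_list_words[OF incr_lists, of I N p q "\<lambda>_. 1"]
    by (simp add: map_replicate_const)
  then show ?thesis by (simp add: e_wedge_def e_def[abs_def])
qed

lemma finite_incr [simp]: "finite (incr N p)"
  by (rule finite_subset[OF _ finite_lists_length_eq[of "{1..N+1}" p]]) (auto simp: incr_def)

lemma incr_tensor_pow: "I \<in> incr N p \<Longrightarrow> word I s \<in> tensor_pow N p"
  by (auto simp: incr_def tensor_pow_def)

lemma tensor_pow_sum: "(\<And>i. i \<in> S \<Longrightarrow> f i \<in> tensor_pow N p) \<Longrightarrow> sum f S \<in> tensor_pow N p"
proof (induction S rule: infinite_finite_induct)
  case (insert i S)
  then show ?case
    using keys_add[of "f i" "sum f S"] by (force simp: tensor_pow_def)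
qed (simp_all add: tensor_pow_def)

lemma normal_form_incr_sum:
  assumes "S \<subseteq> incr N p"
  shows "normal_form q (\<Sum>I\<in>S. word I (a I)) = (\<Sum>I\<in>S. word I (a I))"
  unfolding normal_form_sum using assms
  by (intro sum.cong refl normal_form_strict_sorted) (auto simp: incr_def)

text \<open>Words with a repeated letter get sign 0, and sorting a word with distinct letters makes
  it strictly increasing.\<close>

lemma keys_normal_form:
  assumes "x \<in> tensor_pow N p"
  shows "Poly_Mapping.keys (normal_form q x) \<subseteq> incr N p"
proof
  fix I assume "I \<in> Poly_Mapping.keys (normal_form q x)"
  then have "(\<Sum>w\<in>Poly_Mapping.keys x. Poly_Mapping.lookup (word (sort w)
      (Poly_Mapping.lookup x w * wedge_sign q w)) I) \<noteq> 0"
    by (simp add: in_keys_iff normal_form_def lookup_sum)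
  then obtain w where w: "w \<in> Poly_Mapping.keys x"
    "Poly_Mapping.lookup (word (sort w) (Poly_Mapping.lookup x w * wedge_sign q w)) I \<noteq> 0"
    by (meson sum.neutral)
  then have "I = sort w" "distinct w"
    by (auto simp: lookup_single when_def wedge_sign_def split: if_splits)
  then show "I \<in> incr N p"
    using w(1) assms by (auto simp: tensor_pow_def incr_def strict_sorted_iff)
qed

text \<open>Strictly increasing words are their own normal forms and linearly independent, so the
  equation defining \<open>coords\<close> can only be solved by the coefficients of the normal
  form.\<close>

lemma coords_class:
  assumes "q \<noteq> 0" "x \<in> tensor_pow N p"
  shows "coords N q p (ext_class N q x) = Poly_Mapping.lookup (normal_form q x)"
proof -
  let ?l = "Poly_Mapping.lookup (normal_form q x)"
  have eq: "(\<Oplus>\<^bsub>ext_alg N q\<^esub>I\<in>incr N p. ext_scale N q (a I) (e_wedge N q I)) =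
      ext_class N q (\<Sum>I\<in>incr N p. word I (a I))" for a
    using assms(1)
    by (intro ext_class_sum) (simp_all add: e_wedge_eq ext_scale_class word_carrier incr_lists del: One_nat_def)
  have x: "x \<in> carrier (tensor_alg N)" using assms(2) by (rule tensor_pow_carrier)
  have sum_carrier: "(\<Sum>I\<in>incr N p. word I (a I)) \<in> carrier (tensor_alg N)" for a
    by (intro tensor_alg_sum_closed word_carrier incr_lists)
  have iff: "ext_class N q x = ext_class N q (\<Sum>I\<in>incr N p. word I (a I)) \<longleftrightarrow>
      normal_form q x = (\<Sum>I\<in>incr N p. word I (a I))" for a
    by (simp add: ext_class_eq_iff[OF assms(1) x sum_carrier] normal_form_incr_sum[OF subset_refl])
  have lookup: "Poly_Mapping.lookup (\<Sum>I\<in>incr N p. word I (a I)) J = (if J \<in> incr N p then a J else 0)"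
    for a J by (simp add: lookup_sum lookup_single when_def)
  show ?thesis
    unfolding coords_def eq iff
  proof (rule the_equality)
    have "normal_form q x = (\<Sum>I\<in>incr N p. word I (?l I))"
      by (rule tensor_decomp_superset[OF finite_incr keys_normal_form[OF assms(2)]])
    then show "(\<forall>I. I \<notin> incr N p \<longrightarrow> ?l I = 0) \<and>
        normal_form q x = (\<Sum>I\<in>incr N p. word I (?l I))"
      using keys_normal_form[OF assms(2), of q] by (auto simp: in_keys_iff subset_iff)
  next
    fix a
    assume a: "(\<forall>I. I \<notin> incr N p \<longrightarrow> a I = 0) \<and> normal_form q x = (\<Sum>I\<in>incr N p. word I (a I))"
    \<comment> \<open>On \<open>incr N p\<close> the coefficients are compared; elsewhere both
      functions are 0, which is what makes the description unique.\<close>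
    show "a = ?l"
    proof
      fix J
      have "?l J = (if J \<in> incr N p then a J else 0)"
        using a lookup by metis
      then show "a J = ?l J" using a by auto
    qed
  qed
qed

section \<open>Inversions of complementary index sequences\<close>

lemma inversions_append:
  "inversions (u @ v) = inversions u + inversions v + (\<Sum>a\<leftarrow>u. length (filter (\<lambda>b. b < a) v))"
  by (induction u) auto

text \<open>Matches the recursive count with the shape of \<open>perm_length\<close>. Pairs of
  positions split by whether the first one is 0.\<close>

lemma inversions_eq_card:
  "inversions w = card {(a, b). a < b \<and> b < length w \<and> w ! b < w ! a}"
proof (induction w)
  case (Cons x w)
  let ?A = "{b. b < length w \<and> w ! b < x}"
    and ?B = "{(a, b). a < b \<and> b < length w \<and> w ! b < w ! a}"
  have "{(a, b). a < b \<and> b < length (x # w) \<and> (x # w) ! b < (x # w) ! a} =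
      (\<lambda>b. (0, Suc b)) ` ?A \<union> (\<lambda>(a, b). (Suc a, Suc b)) ` ?B" (is "?L = ?R")
  proof (intro equalityI subsetI)
    fix p assume "p \<in> ?L"
    then obtain a b where p: "p = (a, b)" "a < b" "b < length (x # w)" "(x # w) ! b < (x # w) ! a"
      by auto
    then obtain b' where "b = Suc b'" by (cases b) auto
    then show "p \<in> ?R" using p by (cases a) (auto simp: image_iff)
  qed auto
  moreover have "finite ?B"
    by (rule finite_subset[of _ "{..<length w} \<times> {..<length w}"]) auto
  then have "card ((\<lambda>b. (0, Suc b)) ` ?A \<union> (\<lambda>(a, b). (Suc a, Suc b)) ` ?B) =
      card ((\<lambda>b. (0 :: nat, Suc b)) ` ?A) + card ((\<lambda>(a, b). (Suc a, Suc b)) ` ?B)"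
    by (intro card_Un_disjoint) auto
  moreover have "card ((\<lambda>b. (0 :: nat, Suc b)) ` ?A) = card ?A"
    by (rule card_image) (auto simp: inj_on_def)
  moreover have "card ((\<lambda>(a, b). (Suc a, Suc b)) ` ?B) = card ?B"
    by (rule card_image) (auto simp: inj_on_def)
  ultimately show ?case
    using Cons.IH by (simp add: length_filter_conv_card)
qed simp

text \<open>N + 1 distinct letters from a set of N + 1 letters exhaust it.\<close>

lemma distinct_incr_append:
  assumes "J \<in> incr N t" "L \<in> incr N r" "t + r = N + 1" "distinct (J @ L)"
  shows "set (J @ L) = {1..N+1}" "sort (J @ L) = [1..<N+2]"
proof -
  have "length (J @ L) = N + 1" "set (J @ L) \<subseteq> {1..N+1}"
    using assms by (auto simp: incr_def)
  then show set: "set (J @ L) = {1..N+1}"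
    using assms(4) by (intro card_subset_eq) (auto simp: distinct_card simp del: set_append)
  show "sort (J @ L) = [1..<N+2]"
    using assms(4) set
    by (intro sorted_distinct_set_unique) (auto simp del: set_append upt_Suc simp add: atLeastLessThanSuc_atLeastAtMost)
qed

lemma incr_full: "incr N (N + 1) = {[1..<N+2]}"
proof -
  have "I = [1..<N+2]" if "I \<in> incr N (N + 1)" for I
  proof -
    \<comment> \<open>The preceding lemma is applied with an empty second sequence.\<close>
    have "[] \<in> incr N 0" by (simp add: incr_def)
    then have "sort (I @ []) = [1..<N+2]"
      using that by (intro distinct_incr_append(2)[of _ N "N+1" _ 0]) (auto simp: incr_def strict_sorted_iff)
    then show ?thesis
      using that by (simp add: incr_def strict_sorted_iff sorted_sort_id del: upt_Suc)
  qed
  moreover have "[1..<N+2] \<in> incr N (N + 1)"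
    by (auto simp: incr_def simp del: upt_Suc)
  ultimately show ?thesis by blast
qed

lemma powi_minus_nat: "(- q) powi (- int n) = (- inverse q) ^ n" for q :: complex
  by (simp add: power_int_minus flip: power_inverse)

text \<open>The top word is 1, ..., N + 1, so a shuffle producing (J, L) must have the values of
  \<open>J @ L\<close> lowered by 1. Such a shuffle exists exactly when \<open>J @ L\<close> is
  distinct, and its length is then the number of inversions of \<open>J @ L\<close>. The coproduct
  coefficient is therefore the sign met in straightening.\<close>

lemma shuffle_sum:
  assumes J: "J \<in> incr N t" and L: "L \<in> incr N r" and tr: "t + r = N + 1"
  shows "(\<Sum>w\<in>shuffles_on t (t + r).
      if J = map (\<lambda>k. [1..<N+2] ! w k) [0..<t] \<and> L = map (\<lambda>k. [1..<N+2] ! w k) [t..<t+r]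
      then (- q) powi (- int (perm_length (t + r) w)) else 0) = wedge_sign q (J @ L)"
proof -
  let ?C = "\<lambda>w. J = map (\<lambda>k. [1..<N+2] ! w k) [0..<t] \<and> L = map (\<lambda>k. [1..<N+2] ! w k) [t..<t+r]"
  have len: "length J = t" "length L = r" using J L by (auto simp: incr_def)
  \<comment> \<open>The \<open>Suc\<close> arises because positions count from 0 and letters from
    1.\<close>
  have C_iff: "?C w \<longleftrightarrow> (\<forall>k<N+1. Suc (w k) = (J @ L) ! k)" if "w \<in> shuffles_on t (t + r)" for w
  proof -
    have lt: "w k < N + 1" if "k < N + 1" for k
      using \<open>w \<in> shuffles_on t (t + r)\<close> that permutes_in_image[of w "{..<N+1}" k]
      by (auto simp: shuffles_on_def tr)
    have "?C w \<longleftrightarrow> J @ L = map (\<lambda>k. [1..<N+2] ! w k) [0..<t+r]"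
      using len by (simp add: upt_add_eq_append[of 0 t r] append_eq_append_conv del: upt_Suc)
    also have "\<dots> \<longleftrightarrow> (\<forall>k<N+1. (J @ L) ! k = [1..<N+2] ! w k)"
      using len tr by (auto simp: list_eq_iff_nth_eq simp del: upt_Suc)
    also have "\<dots> \<longleftrightarrow> (\<forall>k<N+1. Suc (w k) = (J @ L) ! k)"
    proof -
      have "[1..<N+2] ! w k = Suc (w k)" if "k < N + 1" for k
        using lt[OF that] by (simp del: upt_Suc)
      then show ?thesis by metis
    qed
    finally show ?thesis .
  qed
  show ?thesis
  proof (cases "distinct (J @ L)")
    case False
    have no: "\<not> ?C w" if w: "w \<in> shuffles_on t (t + r)" for w
    proof
      assume "?C w"
      then have *: "\<forall>k<N+1. Suc (w k) = (J @ L) ! k" using C_iff[OF w] by blast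
      have "inj w" using w permutes_inj by (auto simp: shuffles_on_def)
      then have "distinct (J @ L)"
        unfolding distinct_conv_nth using * len tr
        by (metis Suc_inject injD length_append)
      then show False using False by simp
    qed
    show ?thesis
      unfolding wedge_sign_def if_not_P[OF False]
      by (intro sum.neutral ballI if_not_P no)
  next
    case True
    \<comment> \<open>The only candidate; being a permutation of the positions forces the identity
      beyond N.\<close>
    define w where "w = (\<lambda>k. if k < N + 1 then (J @ L) ! k - 1 else k)"
    note set = distinct_incr_append(1)[OF J L tr True]
    have pos: "(J @ L) ! k \<in> {1..N+1}" if "k < N + 1" for k
      using nth_mem[of k "J @ L"] that len tr set by auto
    have Suc_w: "Suc (w k) = (J @ L) ! k" if "k < N + 1" for k
      using pos[OF that] that by (simp add: w_def)
    have "w permutes {..<N+1}"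
    proof (rule bij_imp_permutes)
      have "inj_on w {..<N+1}"
      proof (rule inj_onI)
        fix i j assume "i \<in> {..<N+1}" "j \<in> {..<N+1}" "w i = w j"
        then have "(J @ L) ! i = (J @ L) ! j" using Suc_w by (metis lessThan_iff)
        then show "i = j"
          using True \<open>i \<in> _\<close> \<open>j \<in> _\<close> len tr by (simp add: nth_eq_iff_index_eq)
      qed
      moreover have "w ` {..<N+1} \<subseteq> {..<N+1}"
        using pos by (auto simp: w_def) fastforce
      ultimately show "bij_betw w {..<N+1} {..<N+1}"
        by (simp add: bij_betw_def endo_inj_surj)
    qed (simp add: w_def)
    moreover have "strict_mono_on {..<t} w"
    proof (rule strict_mono_onI)
      fix i j assume ij: "i \<in> {..<t}" "j \<in> {..<t}" "i < j"
      then have "J ! i < J ! j"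
        using J len by (intro sorted_wrt_nth_less[of "(<)"]) (auto simp: incr_def)
      then have "Suc (w i) < Suc (w j)"
        using ij len tr by (subst (1 2) Suc_w) (auto simp: nth_append)
      then show "w i < w j" by simp
    qed
    moreover have "strict_mono_on {t..<t+r} w"
    proof (rule strict_mono_onI)
      fix i j assume ij: "i \<in> {t..<t+r}" "j \<in> {t..<t+r}" "i < j"
      then have "L ! (i - t) < L ! (j - t)"
        using L len by (intro sorted_wrt_nth_less[of "(<)"]) (auto simp: incr_def)
      then have "Suc (w i) < Suc (w j)"
        using ij len tr by (subst (1 2) Suc_w) (auto simp: nth_append)
      then show "w i < w j" by simp
    qed
    ultimately have w: "w \<in> shuffles_on t (t + r)"
      by (simp add: shuffles_on_def tr)
    have uniq: "?C v \<longleftrightarrow> v = w" if v: "v \<in> shuffles_on t (t + r)" for v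
    proof -
      have "v k = w k" if "\<forall>k<N+1. Suc (v k) = (J @ L) ! k" for k
      proof (cases "k < N + 1")
        case False
        then show ?thesis
          using v by (auto simp: shuffles_on_def tr w_def permutes_def)
      qed (metis Suc_w that Suc_inject)
      then show ?thesis
        using C_iff[OF v] Suc_w by auto
    qed
    have fin: "finite (shuffles_on t (t + r))"
      by (rule finite_subset[OF _ finite_permutations[of "{..<t+r}"]]) (auto simp: shuffles_on_def)
    have "perm_length (t + r) w = inversions (J @ L)"
    proof -
      have "w b < w a \<longleftrightarrow> (J @ L) ! b < (J @ L) ! a" if "a < b" "b < t + r" for a b
        using Suc_w[of a] Suc_w[of b] that tr by linarith
      then show ?thesis
        unfolding perm_length_def inversions_eq_card
        using len by (intro arg_cong[of _ _ card]) auto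
    qed
    moreover have "(\<Sum>v\<in>shuffles_on t (t + r). if ?C v
        then (- q) powi (- int (perm_length (t + r) v)) else 0) =
      (\<Sum>v\<in>shuffles_on t (t + r). if v = w
        then (- q) powi (- int (perm_length (t + r) v)) else 0)"
      by (intro sum.cong refl if_cong uniq)
    ultimately show ?thesis
      using fin w True by (simp add: wedge_sign_def powi_minus_nat)
  qed
qed

text \<open>The entry at position k, counted from 0, has exactly k smaller ones. Appending a new
  largest letter leaves the earlier counts alone and adds the old length.\<close>

lemma sum_smaller_strict_sorted:
  "sorted_wrt (<) J \<Longrightarrow>
    2 * int (\<Sum>a\<leftarrow>J. length (filter (\<lambda>b. b < a) J)) = int (length J) * (int (length J) - 1)"
  for J :: "nat list"
proof (induction J rule: rev_induct)
  case (snoc x J)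
  then have J: "sorted_wrt (<) J" "\<forall>a\<in>set J. a < x"
    by (auto simp: sorted_wrt_append)
  have "(\<Sum>a\<leftarrow>J. length (filter (\<lambda>b. b < a) (J @ [x]))) =
      (\<Sum>a\<leftarrow>J. length (filter (\<lambda>b. b < a) J))"
    using J(2) by (intro arg_cong[of _ _ sum_list] map_cong) auto
  moreover have "filter (\<lambda>b. b < x) (J @ [x]) = J"
    using J(2) by (simp add: filter_id_conv)
  ultimately show ?case
    using snoc.IH[OF J(1)] by (simp add: algebra_simps)
qed simp

text \<open>Each letter a of \<open>J\<close> has a - 1 smaller letters, divided between
  \<open>J\<close> and \<open>L\<close>. Over all of \<open>J\<close>, those in \<open>L\<close>
  number the inversions of \<open>J @ L\<close> and those in \<open>J\<close> number t (t - 1) /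
  2.\<close>

lemma inversions_complement:
  assumes J: "J \<in> incr N t" and L: "L \<in> incr N r" and tr: "t + r = N + 1"
    and dist: "distinct (J @ L)"
  shows "2 * int (inversions (J @ L)) + int t * (int t + 1) = 2 * int (sum_list J)"
proof -
  have "length (filter (\<lambda>b. b < a) J) + length (filter (\<lambda>b. b < a) L) + 1 = a" if "a \<in> set J" for a
  proof -
    have a: "a \<in> {1..N+1}" using that J by (auto simp: incr_def)
    have "length (filter (\<lambda>b. b < a) (J @ L)) = card ({b. b < a} \<inter> set (J @ L))"
      by (rule distinct_length_filter[OF dist])
    also have "{b. b < a} \<inter> set (J @ L) = {1..<a}"
      using a unfolding distinct_incr_append(1)[OF J L tr dist] by auto
    finally show ?thesis using a by simp
  qed
  then have "sum_list J = (\<Sum>a\<leftarrow>J. length (filter (\<lambda>b. b < a) J) + length (filter (\<lambda>b. b < a) L) + 1)"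
    by (metis (no_types, lifting) map_idI)
  also have "\<dots> = (\<Sum>a\<leftarrow>J. length (filter (\<lambda>b. b < a) J)) +
      (\<Sum>a\<leftarrow>J. length (filter (\<lambda>b. b < a) L)) + t"
    using J by (simp only: sum_list_addf) (simp add: incr_def sum_list_triv)
  also have "(\<Sum>a\<leftarrow>J. length (filter (\<lambda>b. b < a) L)) = inversions (J @ L)"
    using J L by (simp add: inversions_append inversions_sorted incr_def strict_sorted_iff)
  finally show ?thesis
    using sum_smaller_strict_sorted[of J] J by (simp add: incr_def algebra_simps)
qed

section \<open>Eigenvalues of K and the weights in the traces\<close>

definition K_eigenvalue :: "nat \<Rightarrow> complex \<Rightarrow> nat \<Rightarrow> complex" where
  "K_eigenvalue N q j = q powi (int N + 2 - 2 * int j)"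

text \<open>The condition i + 1 = j is written i = j - 1 so that a product over i can be evaluated
  at one index; truncation at j = 0 cannot interfere within the given ranges.\<close>

lemma rho_K_gen_word:
  assumes "i \<in> {1..N}" "j \<in> {1..N+1}"
  shows "rho_K_gen N q i (word [j] s) =
    word [j] (s * ((if i = j then q else 1) * (if i = j - 1 then inverse q else 1)))"
proof -
  have E1: "E1 l l (word [j] s) = (if l = j then word [j] s else 0)" for l
    by (simp add: E1_def lookup_single when_def)
  have sum: "(\<Sum>l\<in>{1..N+1} - {i, i+1}. E1 l l (word [j] s)) =
      (if j \<noteq> i \<and> j \<noteq> i + 1 then word [j] s else 0)"
    unfolding E1 using assms by (subst sum.delta) auto
  have zero: "tscale c 0 = 0" for c by (simp add: tscale_def)
  consider "i = j" "i \<noteq> j - 1" "i + 1 \<noteq> j" | "i \<noteq> j" "i = j - 1" "i + 1 = j"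
    | "i \<noteq> j" "i \<noteq> j - 1" "i + 1 \<noteq> j"
    using assms by fastforce
  then show ?thesis
    unfolding rho_K_gen_def sum unfolding E1
    by cases (simp_all only: if_True if_False simp_thms zero tscale_word add_0_left add_0_right
        mult_1_left mult_1_right mult.commute[of s] eq_commute[of j])
qed

text \<open>Only K_j and K_(j-1) move e_j, so the exponent is j (N + 1 - j) - (j - 1) (N + 2 - j) =
  N + 2 - 2 j.\<close>

lemma rho_K_e:
  assumes "q \<noteq> 0" "j \<in> {1..N+1}"
  shows "rho_K N q (e j) = word [j] (K_eigenvalue N q j)"
proof -
  define g where "g i = (if i = j then q else 1) * (if i = j - 1 then inverse q else 1)" for i
  have pow: "(rho_K_gen N q i ^^ n) (word [j] s) = word [j] (s * g i ^ n)" if "i \<in> {1..N}" for i n s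
    using rho_K_gen_word[OF that assms(2)]
    by (induction n arbitrary: s) (simp_all add: g_def mult_ac)
  have "foldr (\<circ>) (map (\<lambda>i. rho_K_gen N q i ^^ (i * (N + 1 - i))) is) id (word [j] s) =
      word [j] (s * (\<Prod>i\<leftarrow>is. g i ^ (i * (N + 1 - i))))" if "set is \<subseteq> {1..N}" for "is" s
    using that
    by (induction "is" arbitrary: s) (simp_all add: pow mult_ac del: power_mult)
  from this[of "[1..<N+1]" 1]
  have "rho_K N q (e j) = word [j] (\<Prod>i\<leftarrow>[1..<N+1]. g i ^ (i * (N + 1 - i)))"
    by (simp add: rho_K_def e_def subset_iff del: upt_Suc)
  also have "(\<Prod>i\<leftarrow>[1..<N+1]. g i ^ (i * (N + 1 - i))) = (\<Prod>i\<in>{1..N}. g i ^ (i * (N + 1 - i)))"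
    by (subst prod.distinct_set_conv_list[symmetric])
      (simp_all add: atLeastLessThanSuc_atLeastAtMost del: upt_Suc)
  also have "\<dots> = (\<Prod>i\<in>{1..N}. (if i = j then q ^ (i * (N + 1 - i)) else 1) *
      (if i = j - 1 then inverse q ^ (i * (N + 1 - i)) else 1))"
    by (intro prod.cong refl) (auto simp: g_def power_mult_distrib)
  also have "\<dots> = (if j \<in> {1..N} then q ^ (j * (N + 1 - j)) else 1) *
      (if j - 1 \<in> {1..N} then inverse q ^ ((j - 1) * (N + 1 - (j - 1))) else 1)"
    unfolding prod.distrib by (simp only: prod.delta finite_atLeastAtMost)
  \<comment> \<open>At the ends j = N + 1 and j = 1 the absent generator would have exponent 0, so
    no exception remains.\<close>
  also have "\<dots> = q ^ (j * (N + 1 - j)) * inverse q ^ ((j - 1) * (N + 1 - (j - 1)))"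
  proof -
    have "j \<in> {1..N} \<or> N + 1 - j = 0" "j - 1 \<in> {1..N} \<or> j - 1 = 0"
      using assms(2) by auto
    then show ?thesis by auto
  qed
  also have "\<dots> = q powi (int (j * (N + 1 - j)) + - int ((j - 1) * (N + 1 - (j - 1))))"
    using assms(1) by (simp only: power_int_add power_int_minus power_int_of_nat power_inverse simp_thms)
  also have "int (j * (N + 1 - j)) + - int ((j - 1) * (N + 1 - (j - 1))) = int N + 2 - 2 * int j"
  proof -
    have sub: "int (N + 1 - j) = int N + 1 - int j" "int (j - 1) = int j - 1"
      "int (N + 1 - (j - 1)) = int N + 2 - int j"
      using assms(2) by auto
    show ?thesis
      unfolding of_nat_mult sub by (simp add: algebra_simps)
  qed
  finally show ?thesis by (simp add: K_eigenvalue_def)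
qed

text \<open>Here the two weights meet. Only the complement \<open>C\<close> of \<open>J\<close>
  contributes, with q to the power -2 l for l inversions, and \<open>inversions_complement\<close>
  splits -2 l into -t r and the sum of the exponents N + 2 - 2 j over \<open>J\<close>.\<close>

lemma sum_wedge_sign_square:
  assumes "q \<noteq> 0" and J: "J \<in> incr N t" and tr: "t + r = N + 1"
  shows "(\<Sum>L\<in>incr N r. wedge_sign q (J @ L) * wedge_sign q (J @ L)) =
    q powi (- int (t * r)) * prod_list (map (K_eigenvalue N q) J)"
proof -
  define C where "C = sorted_list_of_set ({1..N+1} - set J)"
  have cJ: "card (set J) = t" "set J \<subseteq> {1..N+1}"
    using J by (auto simp: incr_def strict_sorted_iff distinct_card)
  then have C: "C \<in> incr N r"
    using tr card_Diff_subset[of "set J" "{1..N+1}"]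
    by (auto simp: C_def incr_def)
  have dist: "distinct (J @ C)"
    using J by (auto simp: C_def incr_def strict_sorted_iff)
  have uniq: "L = C" if "L \<in> incr N r" "distinct (J @ L)" for L
  proof -
    have "set L = {1..N+1} - set J"
      using distinct_incr_append(1)[OF J that(1) tr that(2)] that(2) by auto
    moreover have "sorted_list_of_set (set L) = L"
      using that(1)
      by (intro sorted_list_of_set.idem_if_sorted_distinct) (auto simp: incr_def strict_sorted_iff)
    ultimately show ?thesis
      unfolding C_def by (simp only:)
  qed
  have "(\<Sum>L\<in>incr N r. wedge_sign q (J @ L) * wedge_sign q (J @ L)) =
      (\<Sum>L\<in>incr N r. if L = C then wedge_sign q (J @ C) * wedge_sign q (J @ C) else 0)"
  proof (intro sum.cong refl)
    fix L assume L: "L \<in> incr N r"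
    show "wedge_sign q (J @ L) * wedge_sign q (J @ L) =
        (if L = C then wedge_sign q (J @ C) * wedge_sign q (J @ C) else 0)"
    proof (cases "L = C")
      case False
      then have "wedge_sign q (J @ L) = 0"
        using uniq[OF L] unfolding wedge_sign_def by metis
      then show ?thesis
        using False by (simp only: mult_zero_left if_False)
    qed (simp only: simp_thms if_True)
  qed
  also have "\<dots> = (- inverse q) ^ inversions (J @ C) * (- inverse q) ^ inversions (J @ C)"
    using C dist by (simp only: sum.delta finite_incr if_True wedge_sign_def)
  also have "\<dots> = q powi (- (2 * int (inversions (J @ C))))"
  proof -
    have "(- inverse q) ^ n * (- inverse q) ^ n = q powi (- (2 * int n))" for n
      by (simp add: power_int_minus power_int_mult power_mult_distrib[symmetric]
          power2_eq_square inverse_mult_distrib flip: power_inverse)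
    then show ?thesis .
  qed
  also have "- (2 * int (inversions (J @ C))) =
      - int (t * r) + (int t * (int N + 2) - 2 * int (sum_list J))"
  proof -
    have r: "int r = int N + 1 - int t" using tr by linarith
    show ?thesis
      using inversions_complement[OF J C tr dist] unfolding of_nat_mult r
      by (simp add: algebra_simps)
  qed
  also have "q powi \<dots> = q powi (- int (t * r)) * q powi (int t * (int N + 2) - 2 * int (sum_list J))"
    using assms(1) by (simp only: power_int_add simp_thms)
  also have "q powi (int (length J) * (int N + 2) - 2 * int (sum_list J)) =
      prod_list (map (K_eigenvalue N q) J)" for J
  proof (induction J)
    case (Cons j J)
    have "int (length (j # J)) * (int N + 2) - 2 * int (sum_list (j # J)) =
        (int N + 2 - 2 * int j) + (int (length J) * (int N + 2) - 2 * int (sum_list J))"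
      by (simp add: algebra_simps)
    then show ?case
      using assms(1) Cons.IH by (simp only: power_int_add simp_thms) (simp add: K_eigenvalue_def)
  qed simp
  from this[of J] have "q powi (int t * (int N + 2) - 2 * int (sum_list J)) =
      prod_list (map (K_eigenvalue N q) J)"
    using J by (simp add: incr_def)
  finally show ?thesis .
qed

section \<open>The two traces\<close>

lemma ext_pow_repr: "X \<in> ext_pow N q p \<Longrightarrow> \<exists>x\<in>tensor_pow N p. X = ext_class N q x"
  by (auto simp: ext_pow_def)

lemma coords_e_wedge:
  assumes "q \<noteq> 0" "L \<in> incr N r"
  shows "coords N q r (e_wedge N q L) L' = (if L' = L then 1 else 0)"
proof -
  have "normal_form q (word L 1) = word L 1"
    using assms(2) by (intro normal_form_strict_sorted) (simp add: incr_def)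
  then show ?thesis
    using coords_class[OF assms(1) incr_tensor_pow[OF assms(2)], of 1]
    by (simp add: e_wedge_eq[OF assms(2)] lookup_single when_def)
qed

text \<open>The top component has a single basis word, so one coordinate and one shuffle sum
  remain.\<close>

lemma delta_top:
  assumes "q \<noteq> 0" "x \<in> tensor_pow N (N + 1)" "t + r = N + 1" "J \<in> incr N t" "L \<in> incr N r"
  shows "delta N q t r (ext_class N q x) (J, L) =
    Poly_Mapping.lookup (normal_form q x) [1..<N+2] * wedge_sign q (J @ L)"
  using shuffle_sum[OF assms(4,5,3), of q] coords_class[OF assms(1,2)]
  unfolding delta_def prod.case assms(3) incr_full by simp

text \<open>Straightening e_J wedge e_L yields the top basis element times the sign of
  \<open>J @ L\<close>, or 0 when a letter is shared.\<close>

lemma wedge_map_top: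
  assumes "q \<noteq> 0" "t + r = N + 1"
  shows "wedge_map N q t r u = ext_class N q
    (word [1..<N+2] (\<Sum>(J, L)\<in>incr N t \<times> incr N r. u (J, L) * wedge_sign q (J @ L)))"
proof -
  let ?S = "incr N t \<times> incr N r" and ?full = "[1..<N+2]"
  have lists: "fst P \<in> lists {1..N+1}" "snd P \<in> lists {1..N+1}" if "P \<in> ?S" for P
    using that unfolding mem_Times_iff
    by (simp_all only: incr_lists[of "fst P" N t] incr_lists[of "snd P" N r])
  have carrier: "word (fst P @ snd P) (u P) \<in> carrier (tensor_alg N)" if "P \<in> ?S" for P
    using lists[OF that] by (intro word_carrier) (simp only: append_in_lists_conv)
  have full: "?full \<in> incr N (N + 1)" unfolding incr_full by simp
  have "wedge_map N q t r u = ext_class N q (\<Sum>P\<in>?S. word (fst P @ snd P) (u P))"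
    unfolding wedge_map_def
  proof (rule ext_class_sum[OF _ carrier])
    fix P assume P: "P \<in> ?S"
    have c: "word (fst P @ snd P) 1 \<in> carrier (tensor_alg N)"
      using lists[OF P] by (intro word_carrier) (simp only: append_in_lists_conv)
    have "e_wedge N q (fst P) \<otimes>\<^bsub>ext_alg N q\<^esub> e_wedge N q (snd P) =
        ext_class N q (word (fst P @ snd P) 1)"
      using P ext_class_mult[OF word_carrier word_carrier, OF lists[OF P]]
      by (auto simp: e_wedge_eq word_mult)
    then show "ext_scale N q (u P) (e_wedge N q (fst P) \<otimes>\<^bsub>ext_alg N q\<^esub> e_wedge N q (snd P)) =
        ext_class N q (word (fst P @ snd P) (u P))"
      using ext_scale_class[OF assms(1) c] by simp
  qed auto
  also have "\<dots> = ext_class N q (word ?full (\<Sum>(J, L)\<in>?S. u (J, L) * wedge_sign q (J @ L)))"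
  proof (subst ext_class_eq_iff[OF assms(1)])
    \<comment> \<open>With a repeated letter the sorted word differs from the full one, but both
      coefficients are 0.\<close>
    have straighten: "word (sort (J @ L)) (u (J, L) * wedge_sign q (J @ L)) =
        word ?full (u (J, L) * wedge_sign q (J @ L))" if "J \<in> incr N t" "L \<in> incr N r" for J L
      using distinct_incr_append(2)[OF that assms(2)]
      by (cases "distinct (J @ L)") (simp_all add: wedge_sign_def)
    have single_sum: "word v (sum f S) = (\<Sum>i\<in>S. word v (f i))" for v and f :: "'b \<Rightarrow> complex" and S
      by (induction S rule: infinite_finite_induct) (simp_all add: single_add)
    have "normal_form q (\<Sum>P\<in>?S. word (fst P @ snd P) (u P)) =
        (\<Sum>P\<in>?S. word ?full (u P * wedge_sign q (fst P @ snd P)))"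
      unfolding normal_form_sum normal_form_word using straighten by (intro sum.cong refl) auto
    also have "\<dots> = word ?full (\<Sum>(J, L)\<in>?S. u (J, L) * wedge_sign q (J @ L))"
      unfolding single_sum by (intro sum.cong refl) auto
    also have "\<dots> = normal_form q \<dots>"
      using full by (intro normal_form_strict_sorted[symmetric]) (simp add: incr_def)
    finally show "normal_form q (\<Sum>P\<in>?S. word (fst P @ snd P) (u P)) =
        normal_form q (word ?full (\<Sum>(J, L)\<in>?S. u (J, L) * wedge_sign q (J @ L)))" .
  qed (rule tensor_alg_sum_closed[OF carrier] word_carrier[OF incr_lists[OF full]] | assumption)+
  finally show ?thesis .
qed

text \<open>If both signs were nonzero, \<open>J\<close> and \<open>J'\<close> would both be the
  increasing complement of \<open>L\<close>. This removes the off-diagonal entries of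
  \<open>A\<close> from the convolution.\<close>

lemma wedge_sign_append_orthogonal:
  assumes "J \<in> incr N t" "J' \<in> incr N t" "L \<in> incr N r" "t + r = N + 1" "J \<noteq> J'"
  shows "wedge_sign q (J @ L) * wedge_sign q (J' @ L) = 0"
proof (rule ccontr)
  assume "\<not> ?thesis"
  then have d: "distinct (J @ L)" "distinct (J' @ L)"
    by (auto simp: wedge_sign_def split: if_splits)
  then have "set J = set J'"
    using distinct_incr_append(1)[OF assms(1,3,4) d(1)] distinct_incr_append(1)[OF assms(2,3,4) d(2)]
    by auto
  then have "J = J'"
    using assms(1,2) by (intro sorted_distinct_set_unique) (auto simp: incr_def strict_sorted_iff)
  then show False using assms(5) by simp
qed

text \<open>The coproduct contributes the sign of \<open>J @ L\<close>, the identity keeps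
  \<open>L\<close>, and the product contributes the sign of \<open>J' @ L\<close>. Orthogonality
  forces \<open>J = J'\<close>, and summing the squared signs over \<open>L\<close> gives the
  weights.\<close>

lemma conv_id_top:
  assumes q: "q \<noteq> 0" and tr: "t + r = N + 1" and X: "X \<in> ext_pow N q (N + 1)"
  shows "conv N q t r A id X = ext_scale N q
    (q powi (- int (t * r)) * (\<Sum>J\<in>incr N t. coords N q t (A (e_wedge N q J)) J *
      prod_list (map (K_eigenvalue N q) J))) X" (is "_ = ext_scale N q (?k * ?s) X")
proof -
  let ?full = "[1..<N+2]" and ?w = "\<lambda>J L. wedge_sign q (J @ L)"
    and ?a = "\<lambda>J. coords N q t (A (e_wedge N q J))"
  obtain x where x: "x \<in> tensor_pow N (N + 1)" "X = ext_class N q x"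
    using ext_pow_repr[OF X] by blast
  \<comment> \<open>\<open>X\<close> is \<open>c\<close> times the top basis element, since the top
    component is a line.\<close>
  define c where "c = Poly_Mapping.lookup (normal_form q x) ?full"
  have full: "?full \<in> incr N (N + 1)" unfolding incr_full by simp
  have "normal_form q x = (\<Sum>I\<in>incr N (N + 1). word I (Poly_Mapping.lookup (normal_form q x) I))"
    by (rule tensor_decomp_superset[OF finite_incr keys_normal_form[OF x(1)]])
  then have nf: "normal_form q x = word ?full c"
    unfolding incr_full c_def by simp
  have "normal_form q (word ?full c) = word ?full c"
    using full by (intro normal_form_strict_sorted) (simp add: incr_def)
  then have X': "X = ext_class N q (word ?full c)"
    using nf x ext_class_eq_iff[OF q tensor_pow_carrier[OF x(1)] word_carrier[OF incr_lists[OF full]]]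
    by simp
  have T: "tensor_map N q t r A id (delta N q t r X) (J', L') =
      (\<Sum>J\<in>incr N t. c * ?w J L' * ?a J J')" if "L' \<in> incr N r" for J' L'
  proof -
    have "tensor_map N q t r A id (delta N q t r X) (J', L') =
        (\<Sum>J\<in>incr N t. \<Sum>L\<in>incr N r. c * ?w J L * (?a J J' * (if L = L' then 1 else 0)))"
      unfolding tensor_map_def prod.case sum.cartesian_product x(2)
    proof (intro sum.cong refl, clarify)
      fix J L assume "J \<in> incr N t" "L \<in> incr N r"
      then show "delta N q t r (ext_class N q x) (J, L) *
          (?a J J' * coords N q r (id (e_wedge N q L)) L') =
          c * ?w J L * (?a J J' * (if L = L' then 1 else 0))"
        using delta_top[OF q x(1) tr] coords_e_wedge[OF q, of L N r L'] by (simp add: c_def)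
    qed
    also have "\<dots> = (\<Sum>J\<in>incr N t. \<Sum>L\<in>incr N r. if L = L' then c * ?w J L' * ?a J J' else 0)"
      by (intro sum.cong refl) auto
    also have "\<dots> = (\<Sum>J\<in>incr N t. c * ?w J L' * ?a J J')"
      using that by simp
    finally show ?thesis .
  qed
  \<comment> \<open>This is the coefficient of the top word in \<open>wedge_map_top\<close>.\<close>
  have "(\<Sum>(J', L')\<in>incr N t \<times> incr N r.
        tensor_map N q t r A id (delta N q t r X) (J', L') * ?w J' L') =
      (\<Sum>J'\<in>incr N t. \<Sum>L'\<in>incr N r. c * ?a J' J' * (?w J' L' * ?w J' L'))"
    unfolding sum.cartesian_product[symmetric]
  proof (intro sum.cong refl)
    fix J' L' assume J': "J' \<in> incr N t" and L': "L' \<in> incr N r"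
    have "tensor_map N q t r A id (delta N q t r X) (J', L') * ?w J' L' =
        (\<Sum>J\<in>incr N t. c * ?a J J' * (?w J L' * ?w J' L'))"
      unfolding T[OF L'] sum_distrib_right by (intro sum.cong refl) (simp add: mult_ac)
    also have "\<dots> = (\<Sum>J\<in>incr N t. if J = J' then c * ?a J' J' * (?w J' L' * ?w J' L') else 0)"
    proof (intro sum.cong refl)
      fix J assume J: "J \<in> incr N t"
      show "c * ?a J J' * (?w J L' * ?w J' L') =
          (if J = J' then c * ?a J' J' * (?w J' L' * ?w J' L') else 0)"
      proof (cases "J = J'")
        case False
        then show ?thesis
          using wedge_sign_append_orthogonal[OF J J' L' tr False, of q] by (simp only: mult_zero_right if_False)
      qed simp
    qed
    also have "\<dots> = c * ?a J' J' * (?w J' L' * ?w J' L')"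
      using J' by simp
    finally show "tensor_map N q t r A id (delta N q t r X) (J', L') * ?w J' L' = \<dots>" .
  qed
  also have "\<dots> = (\<Sum>J\<in>incr N t. c * ?a J J * (?k * prod_list (map (K_eigenvalue N q) J)))"
    by (intro sum.cong refl)
      (simp only: sum_distrib_left[symmetric] sum_wedge_sign_square[OF q _ tr])
  also have "\<dots> = ?k * ?s * c"
    unfolding sum_distrib_left sum_distrib_right by (intro sum.cong refl) (simp only: mult_ac)
  finally have "conv N q t r A id X = ext_class N q (word ?full (?k * ?s * c))"
    unfolding conv_def comp_apply wedge_map_top[OF q tr] by (rule arg_cong)
  also have "\<dots> = ext_scale N q (?k * ?s) X"
    unfolding X' ext_scale_class[OF q word_carrier[OF incr_lists[OF full]]] by simp
  finally show ?thesis .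
qed

text \<open>\<open>conv_id_top\<close> shows that the scalar works. It is unique because the top
  basis element has a nonzero normal form, on which two scalars can be compared.\<close>

lemma q_trace_eq:
  assumes q: "q \<noteq> 0" and "p \<le> N + 1"
  shows "q_trace N q p A = q powi (- int (p * (N + 1 - p))) *
    (\<Sum>J\<in>incr N p. coords N q p (A (e_wedge N q J)) J * prod_list (map (K_eigenvalue N q) J))"
    (is "_ = ?s")
proof -
  let ?w = "word [1..<N+2]"
  have full: "[1..<N+2] \<in> incr N (N + 1)" unfolding incr_full by simp
  have c: "?w s \<in> carrier (tensor_alg N)" for s by (rule word_carrier[OF incr_lists[OF full]])
  have nf: "normal_form q (?w s) = ?w s" for s
    using full by (intro normal_form_strict_sorted) (simp add: incr_def)
  have conv: "conv N q p (N + 1 - p) A id X = ext_scale N q ?s X"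
    if "X \<in> ext_pow N q (N + 1)" for X
    using that assms(2) by (intro conv_id_top[OF q]) auto
  have top: "ext_class N q (?w 1) \<in> ext_pow N q (N + 1)"
    using incr_tensor_pow[OF full] by (simp add: ext_pow_def)
  have uniq: "s = ?s" if "\<forall>X\<in>ext_pow N q (N + 1). conv N q p (N + 1 - p) A id X = ext_scale N q s X" for s
  proof -
    have "ext_scale N q s (ext_class N q (?w 1)) = ext_scale N q ?s (ext_class N q (?w 1))"
      using bspec[OF that top] conv[OF top] by (rule trans[OF sym])
    then have "?w s = ?w ?s"
      by (simp only: ext_scale_class[OF q c] tscale_word mult_1_right ext_class_eq_iff[OF q c c] nf)
    then have "Poly_Mapping.lookup (?w s) [1..<N+2] = Poly_Mapping.lookup (?w ?s) [1..<N+2]"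
      by (rule arg_cong)
    then show ?thesis unfolding lookup_single_eq .
  qed
  show ?thesis
    unfolding q_trace_def by (rule the_equality, rule ballI, erule conv, erule uniq)
qed

text \<open>K is diagonal in the basis e_I, its eigenvalue there being the product of those on the
  factors, so composing with it only weights the diagonal coordinates of \<open>A\<close>.\<close>

lemma quantum_trace_eq:
  assumes q: "q \<noteq> 0"
  shows "quantum_trace N q p A =
    (\<Sum>J\<in>incr N p. coords N q p (A (e_wedge N q J)) J * prod_list (map (K_eigenvalue N q) J))"
  unfolding quantum_trace_def ext_trace_def comp_apply
proof (intro sum.cong refl)
  fix J assume J: "J \<in> incr N p"
  let ?k = "\<lambda>I. prod_list (map (K_eigenvalue N q) I)" and ?a = "coords N q p (A (e_wedge N q J))"
  have "rho_pow_K N q p (A (e_wedge N q J)) =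
      ext_class N q (\<Sum>I\<in>incr N p. word I (?a I * ?k I))"
    unfolding rho_pow_K_def
  proof (rule ext_class_sum)
    fix I assume I: "I \<in> incr N p"
    show c: "word I s \<in> carrier (tensor_alg N)" for s
      by (rule word_carrier[OF incr_lists[OF I]])
    have "map (\<lambda>i. rho_K N q (e i)) I = map (\<lambda>i. word [i] (K_eigenvalue N q i)) I"
      using I by (intro map_cong refl rho_K_e[OF q]) (auto simp: incr_def)
    then show "ext_scale N q (?a I) (wedge_list N q (map (\<lambda>i. rho_K N q (e i)) I)) =
        ext_class N q (word I (?a I * ?k I))"
      by (simp only: wedge_list_words[OF incr_lists[OF I]] ext_scale_class[OF q c] tscale_word)
  qed simp
  then have "coords N q p (rho_pow_K N q p (A (e_wedge N q J))) =
      Poly_Mapping.lookup (\<Sum>I\<in>incr N p. word I (?a I * ?k I))"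
    by (simp only: coords_class[OF q tensor_pow_sum[OF incr_tensor_pow]]
        normal_form_incr_sum[OF subset_refl])
  then show "coords N q p (rho_pow_K N q p (A (e_wedge N q J))) J = ?a J * ?k J"
    using J by (simp add: lookup_sum lookup_single when_def)
qed

theorem theorem3p8:
  fixes N p :: nat and q :: complex and A :: "tensor set \<Rightarrow> tensor set"
  assumes "N \<ge> 1"
    and "q \<noteq> 0" and "\<forall>n::nat. n \<ge> 1 \<longrightarrow> q ^ n \<noteq> 1"
    and "1 \<le> p" and "p \<le> N + 1"
    and "A \<in> ext_End N q p"
  shows "q_trace N q p A = q powi (- int (p * (N + 1 - p))) * quantum_trace N q p A"
  unfolding q_trace_eq[OF \<open>q \<noteq> 0\<close> \<open>p \<le> N + 1\<close>] quantum_trace_eq[OF \<open>q \<noteq> 0\<close>] ..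

end
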